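(* Let $F(x_1,x_2)\in\mathbb{Z}[x_1,x_2]$ be irreducible over $\overline{\mathbb{Q}}$ with $d=\deg_{x_2}(F)\ge1$. Let $B_1,B_2>1$ and $E>1$ with $B_2\le B_1^{E}$ and $\deg F\le E$. Then for any $\varepsilon>0$, $$\#\{x\in\mathbb{Z}^2:|x_1|\le B_1,\ |x_2|\le B_2,\ F(x)=0\}\ll_{E,d,\varepsilon}B_1^{\frac1d+\varepsilon}.$$ *)

theory Defs
  imports Complex_Main "HOL-Algebra.Algebraic_Closure_Type"
begin

text \<open>
  A polynomial \<open>F(x\<^sub>1, x\<^sub>2)\<close> over \<open>R\<close> is represented as an element of \<open>R[x\<^sub>1][x\<^sub>2]\<close>,
  i.e. as an \<open>R poly poly\<close> whose outer variable is \<open>x\<^sub>2\<close>. The coefficient of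
  \<open>x\<^sub>1\<^sup>i x\<^sub>2\<^sup>j\<close> is \<open>coeff (coeff F j) i\<close>, and \<open>deg\<^sub>x\<^sub>2 F\<close> is the outer degree.
  Constants are qualified because HOL-Algebra has its own \<open>degree\<close>, \<open>coeff\<close> and \<open>irreducible\<close>.
\<close>

definition bipoly_eval :: "'a::comm_ring_1 poly poly \<Rightarrow> 'a \<Rightarrow> 'a \<Rightarrow> 'a" where
  "bipoly_eval F x1 x2 = Polynomial.poly (Polynomial.poly F [:x2:]) x1"

definition total_degree :: "'a::zero poly poly \<Rightarrow> nat" where
  "total_degree F = Max (insert 0 {i + j | i j. Polynomial.coeff (Polynomial.coeff F j) i \<noteq> 0})"

lemma finite_total_degree_set:
  "finite {i + j | i j. Polynomial.coeff (Polynomial.coeff F j) i \<noteq> 0}"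
proof (rule finite_subset)
  show "{i + j | i j. Polynomial.coeff (Polynomial.coeff F j) i \<noteq> 0} \<subseteq>
    (\<Union>j\<le>Polynomial.degree F. \<Union>i\<le>Polynomial.degree (Polynomial.coeff F j). {i + j})"
  proof safe
    fix i j assume nz: "Polynomial.coeff (Polynomial.coeff F j) i \<noteq> 0"
    then have "Polynomial.coeff F j \<noteq> 0" by auto
    then have "j \<le> Polynomial.degree F" by (rule Polynomial.le_degree)
    moreover from nz have "i \<le> Polynomial.degree (Polynomial.coeff F j)"
      by (rule Polynomial.le_degree)
    ultimately show "i + j \<in> (\<Union>j\<le>Polynomial.degree F.
        \<Union>i\<le>Polynomial.degree (Polynomial.coeff F j). {i + j})"
      by blast
  qed
qed auto

text \<open>\<open>rat alg_closure\<close> is the field of algebraic numbers. The units of its bivariate polynomial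
  ring are the nonzero constants.\<close>

definition irreducible_over_Qbar :: "int poly poly \<Rightarrow> bool" where
  "irreducible_over_Qbar F \<longleftrightarrow>
     Factorial_Ring.irreducible (map_poly (map_poly of_int) F :: rat alg_closure poly poly)"

definition integral_points :: "int poly poly \<Rightarrow> real \<Rightarrow> real \<Rightarrow> (int \<times> int) set" where
  "integral_points F B1 B2 =
     {(x1, x2). \<bar>real_of_int x1\<bar> \<le> B1 \<and> \<bar>real_of_int x2\<bar> \<le> B2 \<and> bipoly_eval F x1 x2 = 0}"

lemma finite_integral_points: "finite (integral_points F B1 B2)"
proof (rule finite_subset)
  show "integral_points F B1 B2 \<subseteq> {-\<lfloor>B1\<rfloor>..\<lfloor>B1\<rfloor>} \<times> {-\<lfloor>B2\<rfloor>..\<lfloor>B2\<rfloor>}"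
    unfolding integral_points_def by (auto simp: abs_le_iff) linarith+
qed simp

end

theory Submission
  imports Defs "Subresultants.Subresultant_Gcd" "HOL-Number_Theory.Number_Theory"
begin

text \<open>
  A \<open>p\<close>-adic determinant method. If some other polynomial of the same bidegree vanishes on all the
  points, Bezout bounds their number; otherwise Cramer's rule provides an equation whose coefficients
  are polynomially bounded in \<open>B\<^sub>1\<close>. Then \<open>\<partial>F/\<partial>x\<^sub>2\<close> takes polynomially bounded values, so each point at
  which it does not vanish admits a prime \<open>p \<lless> B\<^sub>1\<^sup>\<epsilon>\<close> modulo which it still does not vanish. Let \<open>q\<close> be
  the first power of \<open>p\<close> exceeding a constant times \<open>B\<^sub>1\<^bsup>1/d + \<epsilon>\<^esup>\<close>. The points that are smooth modulo \<open>p\<close>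
  fall into at most \<open>d q\<close> classes, determined by \<open>x\<^sub>1 mod q\<close> and \<open>x\<^sub>2 mod p\<close>. On one class \<open>x\<^sub>2\<close> is
  \<open>p\<close>-adically close to a polynomial in \<open>x\<^sub>1\<close>, hence every \<open>s \<times> s\<close> determinant in the monomials
  \<open>x\<^sub>1\<^sup>i x\<^sub>2\<^sup>j\<close> with \<open>i \<le> M\<close>, \<open>j < d\<close> is divisible by \<open>q\<close> to the power \<open>s(s - 1)/2\<close>. As its size is
  about \<open>B\<^sub>1\<close> to the power \<open>s\<^sup>2/(2d)\<close>, it vanishes. So the class lies on a curve of bounded degree whose
  \<open>x\<^sub>2\<close>-degree is less than \<open>d\<close>, and Bezout bounds its cardinality.
\<close>

section \<open>Determinants\<close>

lemma poly_diff_eq_synthetic_div: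
  fixes f :: "'a::comm_ring_1 poly"
  shows "poly f x - poly f y = (x - y) * poly (synthetic_div f y) x"
proof -
  have "poly (f + smult y (synthetic_div f y)) x = poly (pCons (poly f y) (synthetic_div f y)) x"
    by (simp only: synthetic_div_correct)
  then show ?thesis by (simp add: algebra_simps)
qed

text \<open>Subtracting the row of \<open>t 0\<close> from the other rows of a matrix of size
  \<open>Suc n\<close> makes row i divisible by \<open>t i - t 0\<close>, which yields n factors q.
  The quotients are again values of polynomials at \<open>t i\<close>, so induction on the minors
  supplies the rest, and the exponents add up to \<open>Suc n choose 2\<close>.\<close>

lemma power_dvd_det_poly_values:
  fixes g :: "nat \<Rightarrow> int poly" and t :: "nat \<Rightarrow> int" and q :: int
  assumes "\<And>i j. i < n \<Longrightarrow> j < n \<Longrightarrow> q dvd t i - t j"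
  shows "q ^ (n choose 2) dvd det (mat n n (\<lambda>(i, j). poly (g j) (t i)))"
  using assms
proof (induction n arbitrary: g t)
  case 0
  then show ?case by (simp add: binomial_eq_0)
next
  case (Suc n)
  define h where "h = (\<lambda>j. synthetic_div (g j) (t 0))"
  define A where "A = mat (Suc n) (Suc n) (\<lambda>(i, j). poly (g j) (t i))"
  \<comment> \<open>\<open>L\<close> encodes these row operations; its determinant is the product of
    the \<open>t i - t 0\<close> with i > 0. \<open>B\<close> keeps row 0 and holds the quotients
    below it.\<close>
  define L where "L = mat (Suc n) (Suc n)
    (\<lambda>(i, j). if j = 0 then 1 else if i = j then t i - t 0 else 0)"
  define B where "B = mat (Suc n) (Suc n)
    (\<lambda>(i, j). if i = 0 then poly (g j) (t 0) else poly (h j) (t i))"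
  have carr: "A \<in> carrier_mat (Suc n) (Suc n)" "L \<in> carrier_mat (Suc n) (Suc n)"
    "B \<in> carrier_mat (Suc n) (Suc n)"
    by (auto simp: A_def L_def B_def)
  have "A = L * B"
  proof (rule eq_matI)
    fix i j assume "i < dim_row (L * B)" "j < dim_col (L * B)"
    then have ij: "i < Suc n" "j < Suc n" by (auto simp: L_def B_def)
    have "(L * B) $$ (i, j) = (\<Sum>k<Suc n. L $$ (i, k) * B $$ (k, j))"
      using ij carr by (auto simp: scalar_prod_def atLeast0LessThan)
    also have "\<dots> = L $$ (i, 0) * B $$ (0, j) + (\<Sum>k<n. L $$ (i, Suc k) * B $$ (Suc k, j))"
      by (rule sum.lessThan_Suc_shift)
    also have "(\<Sum>k<n. L $$ (i, Suc k) * B $$ (Suc k, j)) =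
        (\<Sum>k<n. if i = Suc k then (t i - t 0) * poly (h j) (t i) else 0)"
      using ij by (intro sum.cong) (auto simp: L_def B_def)
    also have "\<dots> = (if i = 0 then 0 else (t i - t 0) * poly (h j) (t i))"
      using ij by (cases i) auto
    also have "L $$ (i, 0) * B $$ (0, j) = poly (g j) (t 0)"
      using ij by (simp add: L_def B_def)
    finally show "A $$ (i, j) = (L * B) $$ (i, j)"
      using ij poly_diff_eq_synthetic_div[of "g j" "t i" "t 0"]
      by (cases i) (auto simp: A_def h_def)
  qed (auto simp: A_def L_def B_def)
  then have "det A = det L * det B"
    using carr by (simp add: det_mult)
  moreover have "q ^ n dvd det L"
  proof -
    have "det L = prod_list (diag_mat L)"
      by (rule det_lower_triangular[OF _ carr(2)]) (auto simp: L_def)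
    also have "\<dots> = (\<Prod>i = 0..<Suc n. L $$ (i, i))"
      using carr by (simp add: prod_list_diag_prod)
    also have "\<dots> = (\<Prod>i<n. t (Suc i) - t 0)"
      by (simp only: atLeast0LessThan prod.lessThan_Suc_shift) (simp add: L_def)
    finally have "det L = (\<Prod>i<n. t (Suc i) - t 0)" .
    moreover have "(\<Prod>i<n. q) dvd (\<Prod>i<n. t (Suc i) - t 0)"
      by (intro prod_dvd_prod) (auto intro: Suc.prems)
    ultimately show ?thesis by simp
  qed
  moreover have "q ^ (n choose 2) dvd det B"
  proof -
    \<comment> \<open>Row 0 of \<open>B\<close> is the only one not made of quotients. Expanding
      along it leaves minors to which the induction hypothesis applies, with column j
      skipped.\<close>
    have "det B = (\<Sum>j<Suc n. B $$ (0, j) * cofactor B 0 j)"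
      by (rule laplace_expansion_row[OF carr(3)]) simp
    moreover have "q ^ (n choose 2) dvd cofactor B 0 j" if "j < Suc n" for j
    proof -
      have "mat_delete B 0 j =
          mat n n (\<lambda>(i, k). poly (h (if k < j then k else Suc k)) (t (Suc i)))"
        by (rule eq_matI) (auto simp: mat_delete_def B_def)
      moreover have "q ^ (n choose 2) dvd
          det (mat n n (\<lambda>(i, k). poly (h (if k < j then k else Suc k)) (t (Suc i))))"
        by (rule Suc.IH) (auto intro: Suc.prems)
      ultimately show ?thesis by (simp add: cofactor_def)
    qed
    ultimately show ?thesis by (auto intro!: dvd_sum simp del: sum.lessThan_Suc)
  qed
  ultimately have "q ^ n * q ^ (n choose 2) dvd det A"
    by (simp add: mult_dvd_mono)
  then show ?case
    by (simp add: A_def power_add numeral_2_eq_2)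
qed

text \<open>In the Leibniz formula every term takes exactly one entry from each column, so bounds
  per column suffice. Passing to the transpose turns the product over rows into one over
  columns.\<close>

lemma abs_det_le:
  fixes f :: "nat \<Rightarrow> nat \<Rightarrow> int" and h :: "nat \<Rightarrow> real"
  assumes "\<And>i j. i < n \<Longrightarrow> j < n \<Longrightarrow> \<bar>real_of_int (f i j)\<bar> \<le> h j"
  shows "\<bar>real_of_int (det (mat n n (\<lambda>(i, j). f i j)))\<bar> \<le> fact n * (\<Prod>j<n. h j)"
proof -
  define A where "A = mat n n (\<lambda>(i, j). f i j)"
  have "det A = det (transpose_mat A)"
    by (rule det_transpose[symmetric, of _ n]) (simp add: A_def)
  also have "\<dots> = (\<Sum>p\<in>{p. p permutes {0..<n}}.
      signof p * (\<Prod>i = 0..<n. (transpose_mat A) $$ (i, p i)))"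
    by (rule det_def') (simp add: A_def)
  finally have "\<bar>real_of_int (det A)\<bar> \<le> (\<Sum>p\<in>{p. p permutes {0..<n}}.
      \<bar>real_of_int (signof p * (\<Prod>i = 0..<n. (transpose_mat A) $$ (i, p i)))\<bar>)"
    by (simp only: of_int_sum) (rule sum_abs)
  also have "\<dots> \<le> (\<Sum>p\<in>{p. p permutes {0..<n}}. \<Prod>j<n. h j)"
  proof (rule sum_mono)
    fix p assume "p \<in> {p. p permutes {0..<n}}"
    then have p: "p permutes {0..<n}" by simp
    have pl: "p i < n" if "i < n" for i
      using permutes_in_image[OF p, of i] that by simp
    have "\<bar>real_of_int (signof p * (\<Prod>i = 0..<n. (transpose_mat A) $$ (i, p i)))\<bar>
        = (\<Prod>i<n. \<bar>real_of_int (f (p i) i)\<bar>)"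
      using pl by (auto simp: abs_mult abs_prod sign_def A_def atLeast0LessThan intro!: prod.cong)
    also have "\<dots> \<le> (\<Prod>i<n. h i)"
      using assms pl by (intro prod_mono) auto
    finally show "\<bar>real_of_int (signof p * (\<Prod>i = 0..<n. (transpose_mat A) $$ (i, p i)))\<bar>
        \<le> (\<Prod>j<n. h j)" .
  qed
  also have "\<dots> = fact n * (\<Prod>j<n. h j)"
    by (simp add: card_permutations[OF refl])
  finally show ?thesis by (simp add: A_def)
qed

text \<open>Cramer's rule: descend until the first n functions have a nonzero determinant at some
  points of \<open>S\<close>, then border it with the next function and a free point y. The bordered
  determinant vanishes, and its expansion along the row of y is a relation whose coefficients are
  minors, hence bounded.\<close>

lemma bounded_relation_if_dets_vanish:
  fixes f :: "nat \<Rightarrow> 'x \<Rightarrow> int" and H :: real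
  assumes "\<And>x. (\<And>i. i < n \<Longrightarrow> x i \<in> S) \<Longrightarrow> det (mat n n (\<lambda>(i, j). f j (x i))) = 0"
    and "\<And>x j. x \<in> S \<Longrightarrow> j < n \<Longrightarrow> \<bar>real_of_int (f j x)\<bar> \<le> H" and "H \<ge> 1"
  shows "\<exists>c. (\<exists>j<n. c j \<noteq> 0) \<and> (\<forall>x\<in>S. (\<Sum>j<n. c j * f j x) = 0) \<and>
    (\<forall>j<n. \<bar>real_of_int (c j)\<bar> \<le> fact n * H ^ n)"
  using assms(1,2)
proof (induction n)
  case 0
  \<comment> \<open>The empty determinant is 1, so the hypothesis cannot hold for size 0.\<close>
  from 0(1)[of undefined] show ?case by simp
next
  case (Suc n)
  have fH: "fact n * H ^ n \<le> fact (Suc n) * H ^ Suc n"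
    using \<open>H \<ge> 1\<close> by (intro mult_mono fact_mono power_increasing) auto
  show ?case
  proof (cases "\<forall>x. (\<forall>i<n. x i \<in> S) \<longrightarrow> det (mat n n (\<lambda>(i, j). f j (x i))) = 0")
    case True
    then obtain c where c: "\<exists>j<n. c j \<noteq> 0" "\<And>x. x \<in> S \<Longrightarrow> (\<Sum>j<n. c j * f j x) = 0"
      "\<And>j. j < n \<Longrightarrow> \<bar>real_of_int (c j)\<bar> \<le> fact n * H ^ n"
      using Suc.IH[OF _ Suc.prems(2)] by auto
    define c' where "c' = c(n := 0)"
    have "\<exists>j<Suc n. c' j \<noteq> 0"
      using c(1) by (auto simp: c'_def less_Suc_eq)
    moreover have "(\<Sum>j<Suc n. c' j * f j x) = 0" if "x \<in> S" for x
      using c(2)[OF that] by (simp add: c'_def)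
    moreover have "\<bar>real_of_int (c' j)\<bar> \<le> fact (Suc n) * H ^ Suc n" if "j < Suc n" for j
      using c(3)[of j] fH \<open>H \<ge> 1\<close> that
      by (cases "j = n") (auto simp: c'_def less_Suc_eq simp del: fact_Suc power_Suc)
    ultimately show ?thesis by blast
  next
    case False
    then obtain x where x: "\<And>i. i < n \<Longrightarrow> x i \<in> S"
      and nz: "det (mat n n (\<lambda>(i, j). f j (x i))) \<noteq> 0" by auto
    \<comment> \<open>These are the cofactors of the last row of the bordered matrix. They do not
      involve y, and \<open>c n\<close> is the nonzero determinant just obtained.\<close>
    define c where "c = (\<lambda>j. (-1) ^ (n + j) *
      det (mat n n (\<lambda>(i, k). f (if k < j then k else Suc k) (x i))))"
    have "c n \<noteq> 0"
    proof -
      have "mat n n (\<lambda>(i, k). f (if k < n then k else Suc k) (x i)) =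
          mat n n (\<lambda>(i, j). f j (x i))"
        by (rule eq_matI) auto
      then show ?thesis using nz by (simp add: c_def)
    qed
    moreover have "(\<Sum>j<Suc n. c j * f j y) = 0" if y: "y \<in> S" for y
    proof -
      define A where "A = mat (Suc n) (Suc n) (\<lambda>(i, j). f j ((x(n := y)) i))"
      have "det A = 0"
        unfolding A_def by (rule Suc.prems(1)) (use x y in \<open>auto simp: less_Suc_eq\<close>)
      moreover have "det A = (\<Sum>j<Suc n. A $$ (n, j) * cofactor A n j)"
        by (rule laplace_expansion_row) (auto simp: A_def)
      moreover have "A $$ (n, j) * cofactor A n j = c j * f j y" if "j < Suc n" for j
      proof -
        have "mat_delete A n j = mat n n (\<lambda>(i, k). f (if k < j then k else Suc k) (x i))"
          by (rule eq_matI) (auto simp: mat_delete_def A_def)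
        then show ?thesis using that by (simp add: cofactor_def c_def A_def)
      qed
      ultimately show ?thesis by simp
    qed
    moreover have "\<bar>real_of_int (c j)\<bar> \<le> fact (Suc n) * H ^ Suc n" if "j < Suc n" for j
    proof -
      have "\<bar>real_of_int (det (mat n n (\<lambda>(i, k). f (if k < j then k else Suc k) (x i))))\<bar>
          \<le> fact n * (\<Prod>j<n. H)"
        by (rule abs_det_le) (use x Suc.prems(2) in auto)
      then show ?thesis using fH by (simp add: c_def abs_mult del: fact_Suc power_Suc)
    qed
    ultimately show ?thesis by blast
  qed
qed

section \<open>Bivariate polynomials and Bezout's bound\<close>

text \<open>\<open>bipoly_eval\<close> substitutes x2 first. Substituting x1 first gives a
  univariate polynomial on the vertical line x1 = a, to which root counts and derivatives
  apply.\<close>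

lemma bipoly_eval_eq_poly_map: "bipoly_eval F a b = poly (map_poly (\<lambda>c. poly c a) F) b"
proof -
  interpret comm_ring_hom "\<lambda>c. poly c a"
    by unfold_locales auto
  show ?thesis unfolding bipoly_eval_def
    by (induction F) (auto simp: hom_distribs)
qed

lemma poly_eq_sum_atMost:
  fixes p :: "'a::comm_ring_1 poly"
  assumes "degree p \<le> n"
  shows "poly p x = (\<Sum>i\<le>n. coeff p i * x ^ i)"
  unfolding poly_altdef using assms
  by (intro sum.mono_neutral_left) (auto simp: coeff_eq_0)

lemma bipoly_eval_eq_sum:
  assumes "degree F \<le> n"
  shows "bipoly_eval F a b = (\<Sum>j\<le>n. poly (coeff F j) a * b ^ j)"
proof -
  have "degree (map_poly (\<lambda>c. poly c a) F) \<le> n"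
    using assms degree_map_poly_le le_trans by blast
  then show ?thesis
    by (simp add: bipoly_eval_eq_poly_map poly_eq_sum_atMost coeff_map_poly)
qed

text \<open>A single index k encodes the monomial with x1-exponent \<open>k mod m\<close> and
  x2-exponent \<open>k div m\<close>, so that a linear relation between the columns of a determinant
  of monomials becomes a polynomial.\<close>

definition bipoly_of :: "nat \<Rightarrow> nat \<Rightarrow> (nat \<Rightarrow> 'a::comm_ring_1) \<Rightarrow> 'a poly poly" where
  "bipoly_of m n c = (\<Sum>j<n. monom (\<Sum>i<m. monom (c (j * m + i)) i) j)"

lemma coeff_coeff_bipoly_of:
  "coeff (coeff (bipoly_of m n c) j) i = (if i < m \<and> j < n then c (j * m + i) else 0)"
  by (simp add: bipoly_of_def coeff_sum if_distrib[of "\<lambda>p. coeff p i"] sum.If_cases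
      cong: if_cong)

lemma degree_coeff_bipoly_of:
  assumes "m > 0" shows "degree (coeff (bipoly_of m n c) j) \<le> m - 1"
  by (rule degree_le) (use assms in \<open>auto simp: coeff_coeff_bipoly_of\<close>)

lemma degree_bipoly_of:
  assumes "n > 0" shows "degree (bipoly_of m n c) \<le> n - 1"
  by (rule degree_le) (use assms in \<open>auto simp: coeff_coeff_bipoly_of poly_eq_iff\<close>)

lemma bipoly_of_eq_0_iff:
  "bipoly_of m n c = 0 \<longleftrightarrow> (\<forall>k<m * n. c k = 0)"
proof
  assume "bipoly_of m n c = 0"
  show "\<forall>k<m * n. c k = 0"
  proof safe
    fix k assume k: "k < m * n"
    then have "k mod m < m" "k div m < n"
      by (cases "m = 0"; simp add: less_mult_imp_div_less mult.commute)+
    then have "coeff (coeff (bipoly_of m n c) (k div m)) (k mod m) = c k"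
      by (simp add: coeff_coeff_bipoly_of)
    then show "c k = 0" using \<open>bipoly_of m n c = 0\<close> by simp
  qed
next
  assume *: "\<forall>k<m * n. c k = 0"
  have "c (j * m + i) = 0" if "i < m" "j < n" for i j
  proof -
    have "j * m + i < Suc j * m" using that by simp
    also have "\<dots> \<le> n * m" using that by (intro mult_le_mono1) auto
    finally show ?thesis using * by (simp add: mult.commute)
  qed
  then show "bipoly_of m n c = 0"
    by (auto simp: poly_eq_iff coeff_coeff_bipoly_of)
qed

lemma sum_div_mod:
  fixes f :: "nat \<Rightarrow> nat \<Rightarrow> 'a::comm_monoid_add"
  shows "(\<Sum>k<m * n. f (k div m) (k mod m)) = (\<Sum>j<n. \<Sum>i<m. f j i)"
proof (induction n)
  case (Suc n)
  have "(\<Sum>k<m * Suc n. f (k div m) (k mod m)) =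
      (\<Sum>k<m * n. f (k div m) (k mod m)) + (\<Sum>k = m * n..<m * n + m. f (k div m) (k mod m))"
    using sum.atLeastLessThan_concat[of 0 "m * n" "m * n + m" "\<lambda>k. f (k div m) (k mod m)"]
    by (simp add: atLeast0LessThan add.commute)
  also have "(\<Sum>k = m * n..<m * n + m. f (k div m) (k mod m)) =
      (\<Sum>i = 0..<m. f ((i + m * n) div m) ((i + m * n) mod m))"
    using sum.shift_bounds_nat_ivl[of "\<lambda>k. f (k div m) (k mod m)" 0 "m * n" m]
    by (simp add: add.commute)
  also have "\<dots> = (\<Sum>i<m. f n i)"
    by (intro sum.cong) auto
  finally show ?case using Suc.IH by simp
qed auto

lemma bipoly_eval_bipoly_of:
  "bipoly_eval (bipoly_of m n c) a b = (\<Sum>k<m * n. c k * (a ^ (k mod m) * b ^ (k div m)))"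
proof -
  have "bipoly_eval (bipoly_of m n c) a b = (\<Sum>j<n. \<Sum>i<m. c (j * m + i) * (a ^ i * b ^ j))"
    by (simp add: bipoly_of_def bipoly_eval_def poly_sum poly_monom sum_distrib_right
        poly_power mult.assoc)
  also have "\<dots> = (\<Sum>k<m * n. c (k div m * m + k mod m) * (a ^ (k mod m) * b ^ (k div m)))"
    by (rule sum_div_mod[symmetric])
  finally show ?thesis by simp
qed

lemma bipoly_of_coeffs:
  assumes "\<And>j. degree (coeff F j) < m" "degree F < n"
  shows "bipoly_of m n (\<lambda>k. coeff (coeff F (k div m)) (k mod m)) = F"
  using assms
  by (intro poly_eqI) (auto simp: coeff_coeff_bipoly_of coeff_eq_0 not_less
     intro: coeff_eq_0 less_le_trans)

text \<open>The Sylvester matrix specialized at x1 = a maps the vector of descending powers of b to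
  multiples of F(a, b) and G(a, b), hence to zero. Specializing entrywise keeps the size of the
  matrix even where leading coefficients vanish at a.\<close>

lemma poly_resultant_eq_0_if_common_zero:
  fixes F G :: "'a::idom poly poly"
  assumes "bipoly_eval F a b = 0" "bipoly_eval G a b = 0" "degree F > 0"
  shows "poly (resultant F G) a = 0"
proof -
  define m where "m = degree F"
  define n where "n = degree G"
  have ev: "comm_ring_hom (\<lambda>c. poly c a)" by unfold_locales auto
  define S where "S = map_mat (\<lambda>c. poly c a) (sylvester_mat F G)"
  have S: "S \<in> carrier_mat (m + n) (m + n)"
    by (auto simp: S_def m_def n_def)
  define v where "v = vec (m + n) (\<lambda>j. b ^ (m + n - 1 - j))"
  have "S *\<^sub>v v = 0\<^sub>v (m + n)"
  proof (rule eq_vecI)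
    fix i assume "i < dim_vec (0\<^sub>v (m + n) :: 'a vec)"
    then have i: "i < m + n" by simp
    have "(S *\<^sub>v v) $ i = (\<Sum>j<m + n. S $$ (i, j) * b ^ (m + n - 1 - j))"
      using i S by (auto simp: v_def scalar_prod_def atLeast0LessThan)
    also have "\<dots> = 0"
    proof (cases "i < n")
      case True
      have "(\<Sum>j<m + n. S $$ (i, j) * b ^ (m + n - 1 - j)) =
          (\<Sum>j\<in>{i..i + m}. poly (coeff F (m + i - j)) a * b ^ (m + n - 1 - j))"
        using i True by (intro sum.mono_neutral_cong_right)
          (auto simp: S_def m_def n_def sylvester_index_mat)
      also have "\<dots> = (\<Sum>l\<le>m. poly (coeff F l) a * b ^ (n - 1 - i + l))"
        using True by (intro sum.reindex_bij_witness[of _ "\<lambda>l. m + i - l" "\<lambda>j. m + i - j"])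
          (auto intro!: arg_cong[where f = "\<lambda>k. b ^ k"])
      also have "\<dots> = b ^ (n - 1 - i) * bipoly_eval F a b"
        by (simp add: bipoly_eval_eq_sum[of F m] m_def power_add sum_distrib_left algebra_simps)
      finally show ?thesis using assms by simp
    next
      case False
      have "(\<Sum>j<m + n. S $$ (i, j) * b ^ (m + n - 1 - j)) =
          (\<Sum>j\<in>{i - n..i}. poly (coeff G (i - j)) a * b ^ (m + n - 1 - j))"
        using i False by (intro sum.mono_neutral_cong_right)
          (auto simp: S_def m_def n_def sylvester_index_mat)
      also have "\<dots> = (\<Sum>l\<le>n. poly (coeff G l) a * b ^ (m + n - 1 - i + l))"
        using i False by (intro sum.reindex_bij_witness[of _ "\<lambda>l. i - l" "\<lambda>j. i - j"])
          (auto intro!: arg_cong[where f = "\<lambda>k. b ^ k"])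
      also have "\<dots> = b ^ (m + n - 1 - i) * bipoly_eval G a b"
        by (simp add: bipoly_eval_eq_sum[of G n] n_def power_add sum_distrib_left algebra_simps)
      finally show ?thesis using assms by simp
    qed
    finally show "(S *\<^sub>v v) $ i = 0\<^sub>v (m + n) $ i" using i by simp
  qed (use S in auto)
  \<comment> \<open>The last entry of \<open>v\<close> is \<open>b ^ 0 = 1\<close>; positivity of
    \<open>degree F\<close> ensures that this entry exists.\<close>
  moreover have "v \<noteq> 0\<^sub>v (m + n)"
  proof
    assume "v = 0\<^sub>v (m + n)"
    then have "v $ (m + n - 1) = 0\<^sub>v (m + n) $ (m + n - 1)" by simp
    then show False using assms(3) by (simp add: v_def m_def)
  qed
  moreover have "v \<in> carrier_vec (m + n)" by (simp add: v_def)
  ultimately have "det S = 0"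
    using det_0_iff_vec_prod_zero[OF S] by blast
  then show ?thesis
    by (simp add: S_def resultant_def comm_ring_hom.hom_det[OF ev])
qed

text \<open>Every term of the Leibniz expansion is, up to sign, a product of
  \<open>degree F + degree G\<close> entries, each of them zero or a coefficient of F or G.\<close>

lemma degree_resultant_le:
  fixes F G :: "'a::comm_ring_1 poly poly"
  assumes "\<And>j. degree (coeff F j) \<le> D" "\<And>j. degree (coeff G j) \<le> D"
  shows "degree (resultant F G) \<le> (degree F + degree G) * D"
proof -
  define n where "n = degree F + degree G"
  have "sylvester_mat F G \<in> carrier_mat n n"
    by (auto simp: n_def)
  then have "resultant F G = (\<Sum>p\<in>{p. p permutes {0..<n}}.
      signof p * (\<Prod>i = 0..<n. sylvester_mat F G $$ (i, p i)))"
    unfolding resultant_def by (rule det_def')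
  also have "degree \<dots> \<le> n * D"
  proof (rule degree_sum_le)
    fix p assume "p \<in> {p. p permutes {0..<n}}"
    then have "p i < n" if "i < n" for i
      using permutes_in_image[of p "{0..<n}" i] that by simp
    then have "degree (sylvester_mat F G $$ (i, p i)) \<le> D" if "i < n" for i
      using assms that by (auto simp: n_def sylvester_index_mat)
    then have "(\<Sum>i = 0..<n. degree (sylvester_mat F G $$ (i, p i))) \<le> (\<Sum>i = 0..<n. D)"
      by (intro sum_mono) auto
    then have "degree (\<Prod>i = 0..<n. sylvester_mat F G $$ (i, p i)) \<le> n * D"
      using degree_prod_sum_le[of "{0..<n}" "\<lambda>i. sylvester_mat F G $$ (i, p i)"] by simp
    then show "degree (signof p * (\<Prod>i = 0..<n. sylvester_mat F G $$ (i, p i))) \<le> n * D"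
      by (auto simp: sign_def)
  qed (simp add: finite_permutations)
  finally show ?thesis by (simp add: n_def)
qed

section \<open>Divisibility over the algebraic numbers and common zeros of two curves\<close>

abbreviation to_Qbar :: "int poly poly \<Rightarrow> rat alg_closure poly poly" where
  "to_Qbar \<equiv> map_poly (map_poly of_int)"

lemma inj_idom_hom_map_poly_of_int:
  "inj_idom_hom (map_poly of_int :: int poly \<Rightarrow> rat alg_closure poly)"
proof -
  interpret inj_idom_hom "of_int :: int \<Rightarrow> rat alg_closure"
    by unfold_locales auto
  interpret map_poly_inj_idom_hom "of_int :: int \<Rightarrow> rat alg_closure" ..
  show ?thesis ..
qed

interpretation Qbar1: inj_idom_hom "map_poly of_int :: int poly \<Rightarrow> rat alg_closure poly"
  by (rule inj_idom_hom_map_poly_of_int)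

interpretation Qbar2: map_poly_inj_idom_hom "map_poly of_int :: int poly \<Rightarrow> rat alg_closure poly" ..

lemma dvd_to_Qbar: "F dvd G \<Longrightarrow> to_Qbar F dvd to_Qbar G"
  by (rule Qbar2.hom_dvd)

text \<open>If F vanished on the line x1 = a, then x1 - a would divide all its coefficients and so F
  itself. By irreducibility the cofactor would be a unit, and F would not involve x2.\<close>

lemma irreducible_over_Qbar_no_vertical_line:
  assumes "irreducible_over_Qbar F" "degree F > 0"
  shows "map_poly (\<lambda>c. poly c a) F \<noteq> 0"
proof
  assume *: "map_poly (\<lambda>c. poly c a) F = 0"
  have "[:-a, 1:] dvd coeff F j" for j
  proof -
    have "coeff (map_poly (\<lambda>c. poly c a) F) j = 0" using * by simp
    then show ?thesis by (simp add: coeff_map_poly poly_eq_0_iff_dvd)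
  qed
  then have "[:[:-a, 1:]:] dvd F"
    by (simp add: const_poly_dvd_iff)
  then have dvd: "to_Qbar [:[:-a, 1:]:] dvd to_Qbar F"
    by (rule dvd_to_Qbar)
  have irr: "irreducible (to_Qbar F)"
    using assms(1) by (simp add: irreducible_over_Qbar_def)
  define L where "L = to_Qbar [:[:-a, 1:]:]"
  have L: "L = [:[:- of_int a, 1:]:]"
    by (simp add: L_def)
  obtain H where H: "to_Qbar F = L * H" using dvd by (auto simp: L_def)
  then have "L dvd 1 \<or> H dvd 1" using irr by (rule irreducibleD[rotated])
  moreover have "\<not> L dvd 1"
    by (auto simp: L is_unit_poly_iff)
  ultimately have "degree H = 0" by (auto simp: is_unit_poly_iff)
  then have "degree (to_Qbar F) = 0"
    unfolding H L by (metis add.right_neutral degree_mult_eq_0 degree_pCons_0 degree_mult_le le_zero_eq)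
  then show False using assms(2) by simp
qed

text \<open>Eliminating x2 shows that the first coordinates are roots of the resultant, which has
  degree at most \<open>(degree F + e) * D\<close>. Each vertical line then meets F in at most
  \<open>degree F\<close> points.\<close>

lemma common_zeros_bound:
  fixes F G :: "int poly poly"
  assumes F: "irreducible_over_Qbar F" "degree F > 0" "\<And>j. degree (coeff F j) \<le> D"
    and G: "degree G \<le> e" "\<And>j. degree (coeff G j) \<le> D" "\<not> to_Qbar F dvd to_Qbar G"
  defines "Z \<equiv> {(a, b). bipoly_eval F a b = 0 \<and> bipoly_eval G a b = 0}"
  shows "finite Z" "card Z \<le> (degree F + e) * D * degree F"
proof -
  define R where "R = resultant F G"
  have "R \<noteq> 0"
  \<comment> \<open>A vanishing resultant gives a common factor of positive x2-degree. By
    irreducibility it equals F up to a unit over \<open>rat alg_closure\<close>, so F would divide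
    G.\<close>
  proof
    assume "R = 0"
    define h where "h = gcd F G"
    have "degree h \<noteq> 0"
      using \<open>R = 0\<close> by (simp add: R_def resultant_0_gcd h_def)
    have "to_Qbar h dvd to_Qbar F"
      by (rule dvd_to_Qbar) (simp add: h_def)
    then obtain k where k: "to_Qbar F = to_Qbar h * k"
      unfolding dvd_def by blast
    have "irreducible (to_Qbar F)"
      using F(1) by (simp add: irreducible_over_Qbar_def)
    then have "to_Qbar h dvd 1 \<or> k dvd 1"
      using k by (rule irreducibleD)
    moreover have "\<not> to_Qbar h dvd 1"
    proof
      assume "to_Qbar h dvd 1"
      then obtain c where "to_Qbar h = [:c:]" by (auto simp: is_unit_poly_iff)
      then have "degree (to_Qbar h) = 0" by (simp only: degree_pCons_0)
      then show False using \<open>degree h \<noteq> 0\<close> by simp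
    qed
    ultimately have "to_Qbar F dvd to_Qbar h"
      using k by (simp add: mult_unit_dvd_iff)
    also have "to_Qbar h dvd to_Qbar G"
      by (rule dvd_to_Qbar) (simp add: h_def)
    finally show False using G(3) by simp
  qed
  define A where "A = {a. poly R a = 0}"
  have A: "finite A" "card A \<le> degree R"
    using \<open>R \<noteq> 0\<close> by (auto simp: A_def poly_roots_finite card_poly_roots_bound)
  have dR: "degree R \<le> (degree F + e) * D"
    using degree_resultant_le[of F D G] F(3) G(1,2) unfolding R_def
    by (meson add_left_mono le_trans mult_le_mono1)
  define B where "B a = {b. poly (map_poly (\<lambda>c. poly c a) F) b = 0}" for a
  have B: "finite (B a)" "card (B a) \<le> degree F" for a
    using irreducible_over_Qbar_no_vertical_line[OF F(1,2), of a]
      card_poly_roots_bound[of "map_poly (\<lambda>c. poly c a) F"] degree_map_poly_le[of "\<lambda>c. poly c a" F]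
    by (auto simp: B_def poly_roots_finite)
  have sub: "Z \<subseteq> Sigma A B"
    using poly_resultant_eq_0_if_common_zero[of F _ _ G] F(2)
    by (auto simp: Z_def A_def B_def R_def bipoly_eval_eq_poly_map[symmetric])
  have fin: "finite (Sigma A B)" using A B by auto
  show "finite Z" using sub fin by (rule finite_subset)
  have "card Z \<le> card (Sigma A B)" using sub fin by (rule card_mono[rotated])
  also have "\<dots> = (\<Sum>a\<in>A. card (B a))" using A B by (simp add: card_SigmaI)
  also have "\<dots> \<le> card A * degree F" using B by (intro sum_bounded_above[where 'a=nat, simplified])
  also have "\<dots> \<le> (degree F + e) * D * degree F"
    using A dR by (intro mult_le_mono1) auto
  finally show "card Z \<le> (degree F + e) * D * degree F" .
qed

section \<open>Equations of small height\<close>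

text \<open>This allows an equation of small height to take the place of F. Comparing x2-degrees
  shows that the cofactor is free of x2; comparing x1-degrees at index \<open>j0\<close>, where G
  cannot exceed F, shows that it is free of x1. Hence it is a unit.\<close>

lemma same_bidegree_multiple:
  assumes F: "irreducible_over_Qbar F" and j0: "\<And>j. degree (coeff G j) \<le> degree (coeff F j0)"
    "coeff F j0 \<noteq> 0"
    and G: "G \<noteq> 0" "degree G \<le> degree F" and dvd: "to_Qbar F dvd to_Qbar G"
  shows "irreducible_over_Qbar G" "degree G = degree F"
proof -
  obtain Q where Q: "to_Qbar G = to_Qbar F * Q" using dvd unfolding dvd_def by blast
  have nz: "to_Qbar F \<noteq> 0" "to_Qbar G \<noteq> 0" "Q \<noteq> 0" using G(1) Q by auto
  have deg: "degree (to_Qbar G) = degree (to_Qbar F) + degree Q"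
    unfolding Q using nz by (intro degree_mult_eq)
  then have "degree Q = 0" using G(2) by simp
  then obtain r where r: "Q = [:r:]" by (rule degree_eq_zeroE)
  show "degree G = degree F" using deg \<open>degree Q = 0\<close> by simp
  have "coeff (to_Qbar G) j0 = coeff (to_Qbar F) j0 * r"
    unfolding Q r by simp
  then have "map_poly of_int (coeff G j0) = map_poly of_int (coeff F j0) * r"
    by (simp add: coeff_map_poly)
  moreover have "map_poly of_int (coeff F j0) \<noteq> (0 :: rat alg_closure poly)" "r \<noteq> 0"
    using j0(2) nz r by auto
  ultimately have "degree (map_poly of_int (coeff G j0) :: rat alg_closure poly) =
      degree (map_poly of_int (coeff F j0) :: rat alg_closure poly) + degree r"
    by (simp add: degree_mult_eq)
  then have "degree r = 0" using j0(1)[of j0] by simp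
  then obtain s where "r = [:s:]" by (rule degree_eq_zeroE)
  then have "Q dvd 1" using nz r by (simp add: is_unit_pCons_iff)
  then show "irreducible_over_Qbar G"
    using F unfolding irreducible_over_Qbar_def Q by (simp add: irreducible_mult_unit_right)
qed

text \<open>The height of F is uncontrolled, so a bounded equation has to be built from the points.
  The coefficients of F are a linear dependence between the monomials on \<open>S\<close>, hence all
  determinants vanish and Cramer's rule yields G. Either F divides G, and G is a unit times F, or
  Bezout bounds \<open>S\<close>.\<close>

lemma small_height_equation:
  fixes F :: "int poly poly" and H :: real
  assumes F: "irreducible_over_Qbar F" "degree F = d" "d > 0" "\<And>j. degree (coeff F j) \<le> D"
    and S: "\<And>a b. (a, b) \<in> S \<Longrightarrow> bipoly_eval F a b = 0"
    and H: "H \<ge> 1" "\<And>a b i j. (a, b) \<in> S \<Longrightarrow> i \<le> D \<Longrightarrow> j \<le> d \<Longrightarrow>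
       \<bar>real_of_int a\<bar> ^ i * \<bar>real_of_int b\<bar> ^ j \<le> H"
  defines "N \<equiv> (D + 1) * (d + 1)"
  shows "(finite S \<and> card S \<le> (d + d) * D * d) \<or>
    (\<exists>G. irreducible_over_Qbar G \<and> degree G = d \<and> (\<forall>j. degree (coeff G j) \<le> D) \<and>
       (\<forall>(a, b)\<in>S. bipoly_eval G a b = 0) \<and>
       (\<forall>i j. \<bar>real_of_int (coeff (coeff G j) i)\<bar> \<le> fact N * H ^ N))"
proof -
  define T where "T = (\<lambda>j. degree (coeff F j)) ` {..d}"
  have "Max T \<in> T" by (rule Max_in) (auto simp: T_def)
  then obtain j1 where j1: "degree (coeff F j1) = Max T"
    unfolding T_def by (metis (no_types, lifting) imageE)
  have le: "degree (coeff F j) \<le> Max T" for j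
  proof (cases "j \<le> d")
    case True
    then show ?thesis by (intro Max_ge) (auto simp: T_def)
  next
    case False
    then show ?thesis using F(2) by (simp add: coeff_eq_0)
  qed
  \<comment> \<open>If \<open>Max T = 0\<close>, the index \<open>j1\<close> could belong to a zero
    coefficient, because \<open>degree 0 = 0\<close>; the leading index d is safe.\<close>
  define j0 where "j0 = (if Max T = 0 then d else j1)"
  have j0: "degree (coeff F j0) = Max T" "coeff F j0 \<noteq> 0"
    using le[of d] j1 F(2,3) by (auto simp: j0_def)
  \<comment> \<open>The box has the exact bidegree of F rather than the cruder bound
    \<open>D\<close>, so that a nonzero multiple G of F inside it must be a unit times F.\<close>
  define m where "m = Max T + 1"
  define n where "n = d + 1"
  have mD: "m \<le> D + 1" using F(4)[of j0] j0 by (simp add: m_def)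
  have mn: "m * n \<le> N" using mD unfolding N_def n_def by (rule mult_le_mono1)
  define f where "f = (\<lambda>k (a, b). a ^ (k mod m) * b ^ (k div m) :: int)"
  define cF where "cF = (\<lambda>k. coeff (coeff F (k div m)) (k mod m))"
  have cF: "bipoly_of m n cF = F"
    unfolding cF_def using le F(2) by (intro bipoly_of_coeffs) (auto simp: m_def n_def less_Suc_eq_le)
  have "F \<noteq> 0" using F(2,3) by auto
  then obtain k0 where k0: "k0 < m * n" "cF k0 \<noteq> 0"
    using bipoly_of_eq_0_iff[of m n cF] cF by auto
  have "\<exists>c. (\<exists>k<m * n. c k \<noteq> 0) \<and> (\<forall>x\<in>S. (\<Sum>k<m * n. c k * f k x) = 0) \<and>
    (\<forall>k<m * n. \<bar>real_of_int (c k)\<bar> \<le> fact (m * n) * H ^ (m * n))"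
  proof (rule bounded_relation_if_dets_vanish)
    fix x :: "nat \<Rightarrow> int \<times> int" assume x: "\<And>i. i < m * n \<Longrightarrow> x i \<in> S"
    define A where "A = mat (m * n) (m * n) (\<lambda>(i, j). f j (x i))"
    have A: "A \<in> carrier_mat (m * n) (m * n)" by (simp add: A_def)
    define v where "v = vec (m * n) cF"
    have "A *\<^sub>v v = 0\<^sub>v (m * n)"
    proof (rule eq_vecI)
      fix i assume "i < dim_vec (0\<^sub>v (m * n) :: int vec)"
      then have i: "i < m * n" by simp
      have "(A *\<^sub>v v) $ i = (\<Sum>k<m * n. f k (x i) * cF k)"
        using i by (auto simp: A_def v_def scalar_prod_def atLeast0LessThan)
      also have "\<dots> = bipoly_eval (bipoly_of m n cF) (fst (x i)) (snd (x i))"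
        by (simp add: bipoly_eval_bipoly_of f_def case_prod_beta mult.commute)
      also have "\<dots> = 0" using S[of "fst (x i)" "snd (x i)"] x[OF i] by (simp add: cF)
      finally show "(A *\<^sub>v v) $ i = 0\<^sub>v (m * n) $ i" using i by simp
    qed (auto simp: A_def)
    moreover have "v \<noteq> 0\<^sub>v (m * n)"
    proof
      assume "v = 0\<^sub>v (m * n)"
      then have "v $ k0 = 0\<^sub>v (m * n) $ k0" by simp
      then show False using k0 by (simp add: v_def)
    qed
    moreover have "v \<in> carrier_vec (m * n)" by (simp add: v_def)
    ultimately show "det (mat (m * n) (m * n) (\<lambda>(i, j). f j (x i))) = 0"
      using det_0_iff_vec_prod_zero[OF A] unfolding A_def by blast
  next
    fix x k assume x: "x \<in> S" and k: "k < m * n"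
    have "k mod m \<le> D" using mod_less_divisor[of m k] mD unfolding m_def by linarith
    moreover have "k div m \<le> d" using k
      by (simp add: less_mult_imp_div_less mult.commute n_def flip: less_Suc_eq_le)
    ultimately show "\<bar>real_of_int (f k x)\<bar> \<le> H"
      using H(2)[of "fst x" "snd x" "k mod m" "k div m"] x
      by (simp add: f_def case_prod_beta abs_mult power_abs)
  qed (rule H(1))
  then obtain c where c: "\<exists>k<m * n. c k \<noteq> 0" "\<And>x. x \<in> S \<Longrightarrow> (\<Sum>k<m * n. c k * f k x) = 0"
    "\<And>k. k < m * n \<Longrightarrow> \<bar>real_of_int (c k)\<bar> \<le> fact (m * n) * H ^ (m * n)"
    by blast
  define G where "G = bipoly_of m n c"
  have G0: "G \<noteq> 0" using c(1) by (auto simp: G_def bipoly_of_eq_0_iff)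
  have Gd: "degree G \<le> d" using degree_bipoly_of[of n m c] by (simp add: G_def n_def)
  have Gm: "degree (coeff G j) \<le> Max T" for j
    using degree_coeff_bipoly_of[of m n c j] by (simp add: G_def m_def)
  have GD: "degree (coeff G j) \<le> D" for j using Gm[of j] mD by (simp add: m_def)
  have GS: "bipoly_eval G a b = 0" if "(a, b) \<in> S" for a b
    using c(2)[OF that] by (simp add: G_def bipoly_eval_bipoly_of f_def)
  have Gh: "\<bar>real_of_int (coeff (coeff G j) i)\<bar> \<le> fact N * H ^ N" for i j
  proof (cases "i < m \<and> j < n")
    case True
    then have "j * m + i < Suc j * m" by simp
    also have "\<dots> \<le> n * m" using True by (intro mult_le_mono1) auto
    finally have "\<bar>real_of_int (coeff (coeff G j) i)\<bar> \<le> fact (m * n) * H ^ (m * n)"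
      using True c(3)[of "j * m + i"] by (simp add: G_def coeff_coeff_bipoly_of mult.commute)
    also have "\<dots> \<le> fact N * H ^ N"
      using H(1) mn by (intro mult_mono fact_mono power_increasing) auto
    finally show ?thesis .
  next
    case False
    then show ?thesis using H(1) by (auto simp: G_def coeff_coeff_bipoly_of)
  qed
  show ?thesis
  proof (cases "to_Qbar F dvd to_Qbar G")
    case True
    have "irreducible_over_Qbar G \<and> degree G = d"
      using same_bidegree_multiple[OF F(1) _ j0(2) G0 _ True] Gm Gd j0(1) F(2) by simp
    then show ?thesis using GD GS Gh by blast
  next
    case False
    define Z where "Z = {(a, b). bipoly_eval F a b = 0 \<and> bipoly_eval G a b = 0}"
    have "finite Z" "card Z \<le> (d + d) * D * d"
      using common_zeros_bound[of F D G d] F Gd GD False by (auto simp: Z_def)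
    moreover have "S \<subseteq> Z" using S GS by (auto simp: Z_def)
    ultimately have "finite S \<and> card S \<le> (d + d) * D * d"
      by (meson card_mono finite_subset le_trans)
    then show ?thesis by blast
  qed
qed

section \<open>Small primes\<close>

text \<open>The maximum of a finite set of positive integers is at least the cardinality of the set;
  removing it leaves the induction hypothesis.\<close>

lemma fact_card_le_prod:
  fixes S :: "nat set"
  assumes "finite S" "0 \<notin> S"
  shows "fact (card S) \<le> \<Prod>S"
  using assms
proof (induction S rule: finite_linorder_max_induct)
  case (insert b S)
  have "insert b S \<subseteq> {1..b}" using insert
    by (force simp: Suc_le_eq intro: Nat.gr0I)
  then have "card (insert b S) \<le> b" using card_mono[of "{1..b}"] by fastforce
  moreover have "b \<notin> S" using insert by auto
  ultimately have "Suc (card S) \<le> b" using insert by simp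
  moreover have "fact (card S) \<le> \<Prod>S" using insert by auto
  ultimately have "Suc (card S) * fact (card S) \<le> b * \<Prod>S" by (rule mult_le_mono)
  then show ?case using insert \<open>b \<notin> S\<close> by simp
qed auto

lemma power_div_fact_le_exp:
  fixes x :: real
  assumes "x \<ge> 0"
  shows "x ^ n / fact n \<le> exp x"
proof -
  have "(\<lambda>k. x ^ k /\<^sub>R fact k) sums exp x" by (rule exp_converges)
  then have "(\<Sum>k\<in>{n}. x ^ k /\<^sub>R fact k) \<le> exp x"
    using assms sum_le_suminf[of "\<lambda>k. x ^ k /\<^sub>R fact k" "{n}"]
    by (simp add: sums_iff)
  then show ?thesis by (simp add: divide_inverse mult.commute)
qed

lemma prod_dvd_if_pairwise_coprime:
  fixes A :: "nat set"
  assumes "finite A" "\<And>a. a \<in> A \<Longrightarrow> a dvd N"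
    and "\<And>a b. a \<in> A \<Longrightarrow> b \<in> A \<Longrightarrow> a \<noteq> b \<Longrightarrow> coprime a b"
  shows "\<Prod>A dvd N"
  using assms
proof (induction A rule: finite_induct)
  case (insert a A)
  have "coprime a (\<Prod>A)" using insert by (intro prod_coprime_right) auto
  then show ?case using insert by (auto intro: divides_mult)
qed auto

text \<open>Every \<open>n \<le> y\<close> is a product of distinct primes \<open>\<le> y\<close> times a square \<open>\<le> y\<close>.\<close>

lemma le_four_power_card_primes: "y \<le> 4 ^ card {p::nat. prime p \<and> p \<le> y}"
proof -
  define P where "P = {p::nat. prime p \<and> p \<le> y}"
  define r where "r = nat \<lfloor>sqrt y\<rfloor>"
  have P: "finite P" by (simp add: P_def)
  have "{1..y} \<subseteq> (\<lambda>(A, b). \<Prod>A * b ^ 2) ` (Pow P \<times> {1..r})"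
  proof
    fix n assume n: "n \<in> {1..y}"
    define a where "a = squarefree_part n"
    define b where "b = square_part n"
    have nab: "n = a * b ^ 2" unfolding a_def b_def by (rule squarefree_decompose)
    have sf: "squarefree a" by (simp add: a_def)
    have a0: "a \<noteq> 0" and b0: "b \<noteq> 0" using n nab by (auto intro!: Nat.gr0I)
    have "a = \<Prod>(prime_factors a)"
    proof -
      have "a = (\<Prod>p\<in>prime_factors a. p ^ multiplicity p a)"
        using a0 by (simp add: prod_prime_factors)
      also have "\<dots> = (\<Prod>p\<in>prime_factors a. p)"
        using sf a0 squarefree_factorial_semiring'[of a] by (intro prod.cong) auto
      finally show ?thesis .
    qed
    moreover have "prime_factors a \<subseteq> P"
    proof
      fix p assume p: "p \<in> prime_factors a"
      then have "p dvd n" using nab by (auto intro: dvd_mult2)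
      then have "p \<le> y" using n dvd_imp_le[of p n] by auto
      then show "p \<in> P" using p by (auto simp: P_def)
    qed
    moreover have "b \<in> {1..r}"
    proof -
      have "b ^ 2 \<le> y" using nab n a0
        by (metis atLeastAtMost_iff le_trans mult_le_mono1 nat_mult_1 One_nat_def Suc_leI neq0_conv)
      then have "real b ^ 2 \<le> real y" by (metis of_nat_le_iff of_nat_power)
      then have "real b \<le> sqrt y" by (rule real_le_rsqrt)
      then show ?thesis using b0 unfolding r_def by (simp add: le_nat_floor)
    qed
    ultimately show "n \<in> (\<lambda>(A, b). \<Prod>A * b ^ 2) ` (Pow P \<times> {1..r})"
      using nab by (intro image_eqI[of _ _ "(prime_factors a, b)"]) auto
  qed
  \<comment> \<open>At most \<open>2 ^ card P\<close> squarefree parts and sqrt(y) values of b cover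
    y numbers. Cancelling sqrt(y) and squaring turns the base 2 into 4.\<close>
  then have "card {1..y} \<le> card (Pow P \<times> {1..r})"
    using P by (intro surj_card_le) auto
  then have "y \<le> 2 ^ card P * r" using P by (simp add: card_cartesian_product card_Pow)
  then have "real y \<le> 2 ^ card P * real r"
    by (metis of_nat_le_iff of_nat_mult of_nat_numeral of_nat_power)
  also have "\<dots> \<le> 2 ^ card P * sqrt y"
    unfolding r_def by (intro mult_left_mono) (auto simp: of_nat_floor)
  finally have "sqrt y * sqrt y \<le> 2 ^ card P * sqrt y" by simp
  then have "sqrt y \<le> 2 ^ card P"
    by (cases "y = 0") (auto simp del: real_sqrt_mult_self simp: mult_le_cancel_right)
  then have "sqrt y ^ 2 \<le> (2 ^ card P) ^ 2" by (intro power_mono) auto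
  then have "real y \<le> real (4 ^ card P)" by (simp add: power2_eq_square flip: power_mult_distrib)
  then show ?thesis unfolding P_def by (simp only: of_nat_le_iff)
qed

text \<open>If all primes up to y divide N, so does their product, and the factorial of their number
  k is at most N. Since y is at most \<open>4 ^ k\<close>, and factorials outgrow exponentials, y is
  at most a constant times \<open>N powr \<delta>\<close>.\<close>

lemma small_prime_not_dvd:
  fixes \<delta> :: real
  assumes "\<delta> > 0"
  shows "\<exists>C>0. \<forall>N>0. \<exists>p. prime p \<and> \<not> p dvd N \<and> real p \<le> C * real N powr \<delta>"
proof -
  \<comment> \<open>The constant comes from \<open>x ^ k \<le> fact k * exp x\<close> at
    \<open>x = 4 powr (1 / \<delta>)\<close>, raised to the power \<delta>.\<close>
  define K where "K = exp (\<delta> * 4 powr (1 / \<delta>))"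
  have K: "K \<ge> 1" using assms by (simp add: K_def)
  have main: "real y \<le> K * real N powr \<delta>"
    if N: "N > 0" and all: "\<And>p. prime p \<Longrightarrow> p \<le> y \<Longrightarrow> p dvd N" for y N :: nat
  proof -
    define P where "P = {p::nat. prime p \<and> p \<le> y}"
    define k where "k = card P"
    have P: "finite P" by (simp add: P_def)
    have "\<Prod>P dvd N"
      using P all by (intro prod_dvd_if_pairwise_coprime) (auto simp: P_def primes_coprime)
    then have "\<Prod>P \<le> N" using N by (rule dvd_imp_le)
    moreover have "fact k \<le> \<Prod>P" unfolding k_def
      using P by (intro fact_card_le_prod) (auto simp: P_def)
    ultimately have "fact k \<le> N" by linarith
    then have kN: "(fact k :: real) \<le> real N" by (metis of_nat_fact of_nat_le_iff)
    have "(4 powr (1 / \<delta>)) ^ k / fact k \<le> exp (4 powr (1 / \<delta>))"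
      by (rule power_div_fact_le_exp) simp
    then have "(4 powr (1 / \<delta>)) ^ k \<le> fact k * exp (4 powr (1 / \<delta>))"
      by (simp add: divide_le_eq mult.commute)
    also have "\<dots> \<le> real N * exp (4 powr (1 / \<delta>))" using kN by simp
    finally have *: "(4 powr (1 / \<delta>)) ^ k \<le> real N * exp (4 powr (1 / \<delta>))" .
    have "real y \<le> 4 ^ k"
      using le_four_power_card_primes[of y] unfolding k_def P_def
      by (metis of_nat_le_iff of_nat_numeral of_nat_power)
    also have "\<dots> = ((4 powr (1 / \<delta>)) ^ k) powr \<delta>"
      using assms by (simp add: powr_realpow[symmetric] powr_powr)
    also have "\<dots> \<le> (real N * exp (4 powr (1 / \<delta>))) powr \<delta>"
      using * assms by (intro powr_mono2) auto
    also have "\<dots> = K * real N powr \<delta>"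
      by (simp add: powr_mult K_def exp_powr_real mult.commute)
    finally show ?thesis .
  qed
  show ?thesis
  proof (intro exI[of _ "2 * K"] conjI allI impI)
    show "0 < 2 * K" using K by simp
    fix N :: nat assume N: "N > 0"
    define Y where "Y = K * real N powr \<delta>"
    have "real N powr \<delta> \<ge> 1" using N assms by (intro ge_one_powr_ge_zero) auto
    then have Y: "Y \<ge> 1" using K by (simp add: Y_def mult_ge1_I)
    \<comment> \<open>This is the first integer above \<open>Y\<close>. As \<open>Y \<ge> 1\<close>,
      it is at most \<open>2 * Y\<close>, which explains the factor 2 in the constant.\<close>
    define y where "y = Suc (nat \<lfloor>Y\<rfloor>)"
    have "real y > Y" using Y by (simp add: y_def) linarith
    then obtain p where p: "prime p" "p \<le> y" "\<not> p dvd N"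
      using main[OF N, of y] by (force simp: Y_def)
    have "real y \<le> Y + 1" using Y by (simp add: y_def)
    then have "real p \<le> 2 * Y" using p(2) Y by linarith
    then show "\<exists>p. prime p \<and> \<not> p dvd N \<and> real p \<le> 2 * K * real N powr \<delta>"
      using p by (auto simp: Y_def)
  qed
qed

section \<open>Points in a residue class\<close>

lemma bipoly_eval_pCons: "bipoly_eval (pCons c F) a b = poly c a + b * bipoly_eval F a b"
  by (simp add: bipoly_eval_def)

lemma bipoly_eval_pderiv:
  "bipoly_eval (pderiv F) a b = poly (pderiv (map_poly (\<lambda>c. poly c a) F)) b"
proof -
  have "map_poly (\<lambda>c. poly c a) (pderiv F) = pderiv (map_poly (\<lambda>c. poly c a) F)"
    by (rule poly_eqI) (simp add: coeff_map_poly coeff_pderiv)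
  then show ?thesis by (simp add: bipoly_eval_eq_poly_map)
qed

text \<open>The remainder lies in the ring itself, so over the integers the error is divisible by
  the square of \<open>y - z\<close>, as Newton's step requires.\<close>

lemma poly_second_order_expansion:
  fixes f :: "'a::idom poly"
  shows "\<exists>r. poly f y = poly f z + (y - z) * poly (pderiv f) z + (y - z) ^ 2 * r"
proof (induction f)
  case (pCons c f)
  then obtain r where r: "poly f y = poly f z + (y - z) * poly (pderiv f) z + (y - z) ^ 2 * r"
    by blast
  show ?case
    by (rule exI[of _ "poly (pderiv f) z + y * r"])
      (simp add: r pderiv_pCons algebra_simps power2_eq_square)
qed auto

lemma cong_poly:
  fixes f :: "int poly"
  assumes "[x = y] (mod m)"
  shows "[poly f x = poly f y] (mod m)"
  by (induction f) (auto intro!: cong_add cong_mult assms)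

lemma cong_bipoly_eval:
  fixes F :: "int poly poly"
  assumes "[a = a'] (mod m)" "[b = b'] (mod m)"
  shows "[bipoly_eval F a b = bipoly_eval F a' b'] (mod m)"
proof (induction F)
  case 0
  then show ?case by (simp add: bipoly_eval_def)
next
  case (pCons c F)
  then show ?case
    by (auto simp: bipoly_eval_pCons intro!: cong_add cong_mult cong_poly assms)
qed

text \<open>Newton's iteration with a fixed approximate inverse of the derivative: every step gains one
  power of \<open>p\<close>, simultaneously for all points of the residue class.\<close>

lemma hensel_polynomial:
  fixes F :: "int poly poly" and p :: int
  assumes S: "\<And>a b. (a, b) \<in> S \<Longrightarrow> bipoly_eval F a b = 0 \<and> [a = a0] (mod p) \<and> [b = b0] (mod p)"
    and w: "[w * bipoly_eval (pderiv F) a0 b0 = 1] (mod p)"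
  shows "\<exists>f. \<forall>(a, b)\<in>S. p ^ Suc n dvd b - poly f a"
proof (induction n)
  case 0
  show ?case
    by (rule exI[of _ "[:b0:]"]) (use S in \<open>auto simp: cong_iff_dvd_diff\<close>)
next
  case (Suc n)
  then obtain f where f: "\<And>a b. (a, b) \<in> S \<Longrightarrow> p ^ Suc n dvd b - poly f a" by auto
  have "p ^ Suc (Suc n) dvd b - poly (f - smult w (poly F f)) a" if ab: "(a, b) \<in> S" for a b
  proof -
    define z where "z = poly f a"
    define e where "e = b - z"
    define Q where "Q = map_poly (\<lambda>c. poly c a) F"
    have e: "p ^ Suc n dvd e" using f[OF ab] by (simp add: e_def z_def)
    then have pe: "p dvd e" by (rule dvd_trans[rotated]) simp
    obtain r where "poly Q b = poly Q z + e * poly (pderiv Q) z + e ^ 2 * r"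
      using poly_second_order_expansion[of Q b z] by (auto simp: e_def)
    moreover have "poly Q b = 0" using S[OF ab] by (simp add: Q_def bipoly_eval_eq_poly_map)
    moreover have Qz: "poly Q z = poly (poly F f) a"
    proof -
      have "poly (map_poly (\<lambda>c. poly c a) F) (poly f a) = poly (poly F f) a"
        by (induction F) (auto simp: map_poly_pCons)
      then show ?thesis by (simp add: Q_def z_def)
    qed
    ultimately have "poly (poly F f) a = - e * (poly (pderiv Q) z + e * r)"
      by (simp add: algebra_simps power2_eq_square)
    then have "b - poly (f - smult w (poly F f)) a =
        e + w * (- e * (poly (pderiv Q) z + e * r))"
      by (simp add: e_def z_def)
    also have "\<dots> = e * (1 - w * poly (pderiv Q) z - w * e * r)"
      by (simp add: algebra_simps)
    finally have "b - poly (f - smult w (poly F f)) a =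
        e * (1 - w * poly (pderiv Q) z - w * e * r)" .
    \<comment> \<open>Modulo p the derivative at z agrees with that at (a0, b0), since z, b and b0
      are congruent. There w inverts it, and the remaining term contains the factor e, a multiple of
      p.\<close>
    moreover have "p dvd 1 - w * poly (pderiv Q) z - w * e * r"
    proof -
      have "[z = b] (mod p)" using pe by (simp add: e_def cong_iff_dvd_diff dvd_diff_commute)
      then have "[bipoly_eval (pderiv F) a z = bipoly_eval (pderiv F) a0 b0] (mod p)"
        using S[OF ab] by (intro cong_bipoly_eval) (auto intro: cong_trans)
      then have "[w * poly (pderiv Q) z = w * bipoly_eval (pderiv F) a0 b0] (mod p)"
        unfolding Q_def bipoly_eval_pderiv[symmetric] by (intro cong_mult) auto
      then have "[w * poly (pderiv Q) z = 1] (mod p)" using w by (rule cong_trans)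
      then have "p dvd 1 - w * poly (pderiv Q) z"
        by (simp add: cong_iff_dvd_diff dvd_diff_commute)
      then show ?thesis by (rule dvd_diff) (use pe in auto)
    qed
    ultimately have "p ^ Suc n * p dvd b - poly (f - smult w (poly F f)) a"
      using e by (simp only: mult_dvd_mono)
    then show ?thesis by (simp only: power_Suc2)
  qed
  then show ?case by blast
qed

section \<open>Divisibility of determinants of monomials on one residue class\<close>

lemma cong_det:
  fixes f g :: "nat \<Rightarrow> nat \<Rightarrow> int"
  assumes "\<And>i j. i < n \<Longrightarrow> j < n \<Longrightarrow> [f i j = g i j] (mod m)"
  shows "[det (mat n n (\<lambda>(i, j). f i j)) = det (mat n n (\<lambda>(i, j). g i j))] (mod m)"
proof -
  have "[(\<Sum>p\<in>{p. p permutes {0..<n}}. signof p * (\<Prod>i = 0..<n. f i (p i))) =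
      (\<Sum>p\<in>{p. p permutes {0..<n}}. signof p * (\<Prod>i = 0..<n. g i (p i)))] (mod m)"
    using permutes_in_image[of _ "{0..<n}"]
    by (intro cong_sum cong_mult cong_refl cong_prod assms) auto
  moreover have "det (mat n n (\<lambda>(i, j). h i j)) =
      (\<Sum>p\<in>{p. p permutes {0..<n}}. signof p * (\<Prod>i = 0..<n. h i (p i)))"
    for h :: "nat \<Rightarrow> nat \<Rightarrow> int"
    using permutes_in_image[of _ "{0..<n}"]
    by (subst det_def'[of _ n]) (auto intro!: sum.cong prod.cong)
  ultimately show ?thesis by simp
qed

text \<open>Hensel lifting replaces b by a polynomial value f(a) modulo the target power of p. The
  monomials become values of univariate polynomials at points congruent modulo \<open>p ^ k\<close>,
  for which the divisibility is known.\<close>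

lemma power_dvd_det_monomials:
  fixes F :: "int poly poly" and p :: int
  assumes S: "\<And>a b. (a, b) \<in> S \<Longrightarrow> bipoly_eval F a b = 0 \<and> [a = a0] (mod p ^ k) \<and> [b = b0] (mod p)"
    and p: "prime p" "\<not> p dvd bipoly_eval (pderiv F) a0 b0" and k: "k > 0"
    and x: "\<And>i. i < n \<Longrightarrow> x i \<in> S"
  shows "(p ^ k) ^ (n choose 2) dvd det (mat n n (\<lambda>(i, j). fst (x i) ^ e j * snd (x i) ^ l j))"
proof -
  have "coprime (bipoly_eval (pderiv F) a0 b0) p"
    using p by (simp add: prime_imp_coprime coprime_commute)
  then obtain w where w: "[bipoly_eval (pderiv F) a0 b0 * w = 1] (mod p)"
    using cong_solve_coprime_int by blast
  have Sp: "bipoly_eval F a b = 0 \<and> [a = a0] (mod p) \<and> [b = b0] (mod p)" if "(a, b) \<in> S" for a b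
    using S[OF that] k by (auto intro: cong_dvd_modulus dvd_power)
  \<comment> \<open>The precision needed is \<open>p ^ (k * (n choose 2))\<close>; the iteration
    delivers one power more.\<close>
  have "\<exists>f. \<forall>(a, b)\<in>S. p ^ Suc (k * (n choose 2)) dvd b - poly f a"
    using Sp w by (intro hensel_polynomial) (auto simp: mult.commute)
  then obtain f where f: "\<And>a b. (a, b) \<in> S \<Longrightarrow> p ^ Suc (k * (n choose 2)) dvd b - poly f a"
    by blast
  define g where "g j = [:0, 1:] ^ e j * f ^ l j" for j
  have "[det (mat n n (\<lambda>(i, j). fst (x i) ^ e j * snd (x i) ^ l j)) =
      det (mat n n (\<lambda>(i, j). poly (g j) (fst (x i))))] (mod (p ^ k) ^ (n choose 2))"
  proof (rule cong_det)
    fix i j assume "i < n"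
    then have "p ^ Suc (k * (n choose 2)) dvd snd (x i) - poly f (fst (x i))"
      using f x by simp
    then have "p ^ (k * (n choose 2)) dvd snd (x i) - poly f (fst (x i))"
      by (rule dvd_trans[rotated]) (simp add: le_imp_power_dvd)
    then have "[snd (x i) = poly f (fst (x i))] (mod (p ^ k) ^ (n choose 2))"
      by (simp add: cong_iff_dvd_diff power_mult)
    then show "[fst (x i) ^ e j * snd (x i) ^ l j = poly (g j) (fst (x i))] (mod (p ^ k) ^ (n choose 2))"
      by (auto simp: g_def intro: cong_mult cong_pow)
  qed
  moreover have "(p ^ k) ^ (n choose 2) dvd det (mat n n (\<lambda>(i, j). poly (g j) (fst (x i))))"
  proof (rule power_dvd_det_poly_values)
    fix i j assume "i < n" "j < n"
    then have "[fst (x i) = a0] (mod p ^ k)" "[fst (x j) = a0] (mod p ^ k)"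
      using S x by (metis prod.collapse)+
    then have "[fst (x i) = fst (x j)] (mod p ^ k)" by (meson cong_sym cong_trans)
    then show "p ^ k dvd fst (x i) - fst (x j)" by (simp add: cong_iff_dvd_diff)
  qed
  ultimately show ?thesis by (simp add: cong_dvd_iff)
qed

text \<open>Lagrange's bound, obtained by splitting off linear factors over the integers. The
  induction runs over the degree of f itself, which may exceed that of its reduction, so
  nonvanishing modulo p is recorded by an arbitrary coefficient.\<close>

lemma card_roots_mod_prime:
  fixes f :: "int poly" and p :: int
  assumes "prime p" "\<not> p dvd coeff f i" "finite S" "S \<subseteq> {0..<p}" "\<And>b. b \<in> S \<Longrightarrow> p dvd poly f b"
  shows "card S \<le> degree f"
  using assms(2-5)
proof (induction "degree f" arbitrary: f S i)
  case 0
  then obtain c where f: "f = [:c:]" by (metis degree_eq_zeroE)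
  have "S = {}"
  proof (rule ccontr)
    assume "S \<noteq> {}"
    then have "p dvd c" using 0 f by auto
    then show False using 0(2) f by (cases i) auto
  qed
  then show ?case by simp
next
  case (Suc n)
  show ?case
  proof (cases "S = {}")
    case False
    then obtain b where b: "b \<in> S" by blast
    define g where "g = synthetic_div f b"
    have fg: "f = [:-b, 1:] * g + [:poly f b:]"
      using synthetic_div_correct'[of b f] by (simp add: g_def)
    \<comment> \<open>Otherwise p would divide every coefficient of f, as it also divides the
      remainder \<open>poly f b\<close>.\<close>
    have "\<exists>j. \<not> p dvd coeff g j"
    proof (rule ccontr)
      assume "\<nexists>j. \<not> p dvd coeff g j"
      then have "[:p:] dvd g" by (simp add: const_poly_dvd_iff)
      moreover have "[:p:] dvd [:poly f b:]" using Suc.prems b by simp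
      ultimately have "[:p:] dvd f" by (subst fg) (intro dvd_add dvd_mult)
      then show False using Suc.prems(1) by (simp add: const_poly_dvd_iff)
    qed
    then obtain j where j: "\<not> p dvd coeff g j" by blast
    have "card (S - {b}) \<le> degree g"
    proof (rule Suc.hyps(1))
      show "n = degree g" using Suc.hyps(2) by (simp add: g_def degree_synthetic_div)
      show "p dvd poly g c" if c: "c \<in> S - {b}" for c
      proof -
        have "p dvd (c - b) * poly g c"
          using Suc.prems(4) b c poly_diff_eq_synthetic_div[of f c b] unfolding g_def
          by (metis DiffD1 dvd_diff)
        moreover have "\<not> p dvd c - b"
        proof
          assume "p dvd c - b"
          then have "[c = b] (mod p)" by (simp add: cong_iff_dvd_diff)
          moreover have "c \<in> {0..<p}" "b \<in> {0..<p}" using Suc.prems(3) b c by blast+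
          ultimately have "c = b" by (intro cong_less_imp_eq_int[of c p b]) auto
          then show False using c by simp
        qed
        ultimately show ?thesis using assms(1) by (simp add: prime_dvd_mult_iff)
      qed
    qed (use j Suc.prems in auto)
    then show ?thesis using Suc.hyps(2) Suc.prems(2) b
      by (simp add: g_def degree_synthetic_div)
  qed auto
qed

text \<open>A polynomial that is zero modulo p has no simple roots there. Restricting to simple
  roots thus covers the fibres F(a, x2) that vanish identically modulo p.\<close>

lemma card_simple_roots_mod_prime:
  fixes f :: "int poly" and p :: int
  assumes "prime p"
  shows "card {b\<in>{0..<p}. p dvd poly f b \<and> \<not> p dvd poly (pderiv f) b} \<le> degree f" (is "card ?S \<le> _")
proof (cases "?S = {}")
  case True
  then show ?thesis by (simp only: card.empty)
next
  case False
  then obtain b where b: "\<not> p dvd poly (pderiv f) b" by auto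
  have "\<exists>i. \<not> p dvd coeff f i"
  proof (rule ccontr)
    assume "\<nexists>i. \<not> p dvd coeff f i"
    then have "p dvd coeff (pderiv f) i * b ^ i" for i by (simp add: coeff_pderiv)
    then have "p dvd poly (pderiv f) b" by (simp add: poly_altdef dvd_sum)
    then show False using b by simp
  qed
  then obtain i where "\<not> p dvd coeff f i" by blast
  then show ?thesis using assms
    by (intro card_roots_mod_prime[of p f i]) (auto intro: finite_subset[of _ "{0..<p}"])
qed

text \<open>Put g = 1/d + 2E/M and t = s(s - 1)/2. From s - 1 \<ge> dM the exponent of B is at most
  g t, and \<open>fact s\<close> is at most s^s, hence at most s^(2t). The left side is therefore at
  most (s^2 B^g)^t, which is why q is compared with s^2 B^g.\<close>

lemma det_size_less_divisor:
  fixes B E q :: real and M d s :: nat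
  assumes "B \<ge> 1" "E > 0" "M > 0" "d > 0" and s: "s = (M + 1) * d"
    and q: "real s ^ 2 * B powr (1 / d + 2 * E / M) < q"
  shows "fact s * B powr (s / 2 * (M + 2 * E * d)) < q ^ (s choose 2)"
proof -
  define t where "t = real s * (real s - 1) / 2"
  have "d * M \<ge> 1" using assms by (simp add: Suc_le_eq)
  have "real s = real d * real M + real d" unfolding s by (simp add: algebra_simps)
  then have s1: "real s - 1 \<ge> real d * real M" using \<open>d > 0\<close> by linarith
  have dM: "real d * real M \<ge> 1"
    using \<open>d * M \<ge> 1\<close> by (metis of_nat_1 of_nat_le_iff of_nat_mult)
  have sp: "real s \<ge> 1" using s1 dM by linarith
  have t1: "t \<ge> real s / 2 * (real d * real M)"
    unfolding t_def using s1 sp mult_left_mono[OF s1, of "real s / 2"] by simp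
  moreover have "real s / 2 * (real d * real M) \<ge> real s / 2 * 1"
    using sp dM by (intro mult_left_mono) auto
  ultimately have t2: "2 * t \<ge> real s" by linarith
  have t0: "t > 0" using t2 sp by linarith
  have tc: "real (s choose 2) = t"
  proof -
    have "even (s * (s - 1))" by auto
    then have "real (s choose 2) = real (s * (s - 1)) / 2"
      by (simp add: choose_two real_of_nat_div)
    then show ?thesis using sp by (simp add: t_def of_nat_diff)
  qed
  define g where "g = 1 / real d + 2 * E / real M"
  have g0: "g \<ge> 0" using assms by (simp add: g_def)
  have Bg: "B powr g > 0" using assms by simp
  have q0: "q > 0" using q sp Bg unfolding g_def[symmetric]
    by (smt (verit) mult_nonneg_nonneg zero_le_power)
  have "fact s \<le> real s ^ s" using fact_le_power[of s, where 'a = real] by simp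
  also have "\<dots> = real s powr s" using sp by (simp add: powr_realpow)
  also have "\<dots> \<le> real s powr (2 * t)" using t2 sp by (intro powr_mono) auto
  finally have 1: "fact s \<le> real s powr (2 * t)" .
  have "real s / 2 * (M + 2 * E * d) = g * (real s / 2 * (real d * real M))"
    using assms by (simp add: g_def field_simps)
  also have "\<dots> \<le> g * t" using t1 g0 by (rule mult_left_mono)
  finally have 2: "B powr (s / 2 * (M + 2 * E * d)) \<le> B powr (g * t)"
    using assms by (intro powr_mono) auto
  have "fact s * B powr (s / 2 * (M + 2 * E * d)) \<le> real s powr (2 * t) * B powr (g * t)"
    using 1 2 by (intro mult_mono) auto
  also have "\<dots> = (real s ^ 2 * B powr g) powr t"
  proof -
    have "real s ^ 2 = real s powr 2" using sp by simp
    then have "(real s ^ 2) powr t = real s powr (2 * t)" by (simp only: powr_powr)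
    then show ?thesis by (simp add: powr_mult powr_powr)
  qed
  also have "\<dots> < q powr t"
    using q t0 unfolding g_def[symmetric] by (intro powr_less_mono2) auto
  also have "\<dots> = q ^ (s choose 2)"
    using q0 by (simp add: powr_realpow flip: tc)
  finally show ?thesis .
qed

text \<open>The determinants are smaller than a power of \<open>p ^ k\<close> that divides them, so
  they vanish. The monomials stop at x2-degree d - 1, which prevents F from dividing the resulting
  equation G, and Bezout's bound applies.\<close>

lemma residue_class_bound:
  fixes F :: "int poly poly" and p :: int and B E :: real
  assumes F: "irreducible_over_Qbar F" "degree F = d" "d > 0" "\<And>j. degree (coeff F j) \<le> D"
    and S: "\<And>a b. (a, b) \<in> S \<Longrightarrow> bipoly_eval F a b = 0 \<and> [a = a0] (mod p ^ k) \<and> [b = b0] (mod p)"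
    and B: "\<And>a b. (a, b) \<in> S \<Longrightarrow> \<bar>real_of_int a\<bar> \<le> B \<and> \<bar>real_of_int b\<bar> \<le> B powr E"
    and p: "prime p" "\<not> p dvd bipoly_eval (pderiv F) a0 b0" "k > 0"
    and par: "B \<ge> 1" "E > 0" "M > 0"
    and q: "real ((M + 1) * d) ^ 2 * B powr (1 / d + 2 * E / M) < real_of_int (p ^ k)"
  shows "finite S \<and> card S \<le> (d + d) * max D M * d"
proof -
  define m where "m = M + 1"
  define s where "s = m * d"
  define f where "f = (\<lambda>k (a, b). a ^ (k mod m) * b ^ (k div m) :: int)"
  \<comment> \<open>The exponent of b is crudely raised to d, while that of a is kept exactly. The
    former only contributes 2E/M to the final exponent; the latter is responsible for 1/d.\<close>
  have size: "\<bar>real_of_int (f k x)\<bar> \<le> B powr (real (k mod m) + E * d)" if "x \<in> S" "k < s" for x k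
  proof -
    obtain a b where x: "x = (a, b)" by fastforce
    have kd: "k div m < d" using that(2) by (simp add: s_def less_mult_imp_div_less mult.commute)
    have "\<bar>real_of_int a\<bar> ^ (k mod m) \<le> B ^ (k mod m)"
      using B[of a b] that x by (intro power_mono) auto
    moreover have "\<bar>real_of_int b\<bar> ^ (k div m) \<le> (B powr E) ^ (k div m)"
      using B[of a b] that x by (intro power_mono) auto
    moreover have "(B powr E) ^ (k div m) \<le> (B powr E) ^ d"
      using kd par by (intro power_increasing ge_one_powr_ge_zero) auto
    moreover have "(B powr E) ^ d = B powr (E * d)"
      using par by (simp add: powr_powr flip: powr_realpow)
    moreover have "B ^ (k mod m) = B powr real (k mod m)"
      using par by (simp add: powr_realpow)
    ultimately have "\<bar>real_of_int a\<bar> ^ (k mod m) * \<bar>real_of_int b\<bar> ^ (k div m) \<le>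
        B powr real (k mod m) * B powr (E * d)"
      by (intro mult_mono) auto
    then show ?thesis by (simp add: f_def x abs_mult power_abs powr_add)
  qed
  have "\<exists>c. (\<exists>k<s. c k \<noteq> 0) \<and> (\<forall>x\<in>S. (\<Sum>k<s. c k * f k x) = 0) \<and>
    (\<forall>k<s. \<bar>real_of_int (c k)\<bar> \<le> fact s * (B powr (M + E * d)) ^ s)"
  proof (rule bounded_relation_if_dets_vanish)
    fix x :: "nat \<Rightarrow> int \<times> int" assume x: "\<And>i. i < s \<Longrightarrow> x i \<in> S"
    define \<Delta> where "\<Delta> = det (mat s s (\<lambda>(i, j). f j (x i)))"
    have "(p ^ k) ^ (s choose 2) dvd \<Delta>"
      unfolding \<Delta>_def f_def case_prod_beta[of _ "x _"]
      by (rule power_dvd_det_monomials[OF S p x])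
    moreover have "\<bar>real_of_int \<Delta>\<bar> < real_of_int ((p ^ k) ^ (s choose 2))"
    proof -
      have "\<bar>real_of_int \<Delta>\<bar> \<le> fact s * (\<Prod>k<s. B powr (real (k mod m) + E * d))"
        unfolding \<Delta>_def by (rule abs_det_le) (use x size in auto)
      also have "(\<Prod>k<s. B powr (real (k mod m) + E * d)) =
          B powr (\<Sum>k<s. real (k mod m) + E * d)"
        using par by (simp add: powr_sum)
      also have "(\<Sum>k<s. real (k mod m) + E * d) = s / 2 * (M + 2 * E * d)"
      proof -
        \<comment> \<open>Over the s monomials the exponent of a averages M/2, and every monomial
          carries \<open>E * d\<close> on account of b.\<close>
        have "(\<Sum>k<s. real (k mod m)) = (\<Sum>j<d. \<Sum>i<m. real i)"
          unfolding s_def by (rule sum_div_mod)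
        also have "(\<Sum>i<m. real i) = real M * (real M + 1) / 2"
          unfolding m_def by (induction M) (auto simp: field_simps)
        finally show ?thesis
          by (simp add: sum.distrib s_def m_def field_simps)
      qed
      also have "fact s * B powr (s / 2 * (M + 2 * E * d)) < real_of_int (p ^ k) ^ (s choose 2)"
        using par F(3) q by (intro det_size_less_divisor) (auto simp: s_def m_def)
      finally show ?thesis by simp
    qed
    then have "\<bar>\<Delta>\<bar> < (p ^ k) ^ (s choose 2)" by linarith
    ultimately have "\<Delta> = 0" using dvd_imp_le_int[of \<Delta> "(p ^ k) ^ (s choose 2)"] by linarith
    then show "det (mat s s (\<lambda>(i, j). f j (x i))) = 0" by (simp add: \<Delta>_def)
  next
    fix x k assume xk: "x \<in> S" "k < s"
    have "real (k mod m) \<le> real M" using mod_less_divisor[of m k] unfolding m_def by linarith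
    then have "B powr (real (k mod m) + E * d) \<le> B powr (M + E * d)"
      using par by (intro powr_mono) auto
    then show "\<bar>real_of_int (f k x)\<bar> \<le> B powr (M + E * d)" using size[OF xk] by linarith
  qed (use par in \<open>auto intro!: ge_one_powr_ge_zero\<close>)
  then obtain c where c: "\<exists>k<s. c k \<noteq> 0" "\<And>x. x \<in> S \<Longrightarrow> (\<Sum>k<s. c k * f k x) = 0"
    by blast
  define G where "G = bipoly_of m d c"
  have G0: "G \<noteq> 0" using c(1) by (auto simp: G_def bipoly_of_eq_0_iff s_def)
  have Gd: "degree G \<le> d - 1" using degree_bipoly_of[of d m c] F(3) by (simp add: G_def)
  have GM: "degree (coeff G j) \<le> max D M" for j
    using degree_coeff_bipoly_of[of m d c j] by (simp add: G_def m_def)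
  have ndvd: "\<not> to_Qbar F dvd to_Qbar G"
  proof
    assume "to_Qbar F dvd to_Qbar G"
    then have "degree (to_Qbar F) \<le> degree (to_Qbar G)"
      using G0 by (intro dvd_imp_degree_le) auto
    then show False using Gd F(2,3) by simp
  qed
  define Z where "Z = {(a, b). bipoly_eval F a b = 0 \<and> bipoly_eval G a b = 0}"
  have "finite Z" "card Z \<le> (d + d) * max D M * d"
    using common_zeros_bound[of F "max D M" G d] F Gd GM ndvd
    by (auto simp: Z_def le_max_iff_disj)
  moreover have "S \<subseteq> Z"
    using S c(2) by (force simp: Z_def G_def bipoly_eval_bipoly_of f_def s_def)
  ultimately show ?thesis by (meson card_mono finite_subset le_trans)
qed

section \<open>Summation over the residue classes that are smooth modulo p\<close>

lemma card_le_mult_card_image: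
  assumes "finite A" "\<And>y. y \<in> f ` A \<Longrightarrow> card {x\<in>A. f x = y} \<le> K"
  shows "card A \<le> K * card (f ` A)"
proof -
  have "card A = card (\<Union>y\<in>f ` A. {x\<in>A. f x = y})" by (intro arg_cong[of _ _ card]) auto
  also have "\<dots> \<le> (\<Sum>y\<in>f ` A. card {x\<in>A. f x = y})" using assms(1) by (intro card_UN_le) auto
  also have "\<dots> \<le> (\<Sum>y\<in>f ` A. K)" using assms(2) by (rule sum_mono)
  finally show ?thesis by (simp add: mult.commute)
qed

text \<open>The fibres of \<open>h\<close> are the residue classes bounded before. For each of the
  \<open>p ^ k\<close> residues of a, the residue of b is a simple root of F(a, x2) modulo p, so at
  most d classes lie over it.\<close>

lemma smooth_points_bound:
  fixes F :: "int poly poly" and p :: int and B E :: real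
  assumes F: "irreducible_over_Qbar F" "degree F = d" "d > 0" "\<And>j. degree (coeff F j) \<le> D"
    and S: "finite S" "\<And>a b. (a, b) \<in> S \<Longrightarrow> bipoly_eval F a b = 0 \<and> \<not> p dvd bipoly_eval (pderiv F) a b"
    and B: "\<And>a b. (a, b) \<in> S \<Longrightarrow> \<bar>real_of_int a\<bar> \<le> B \<and> \<bar>real_of_int b\<bar> \<le> B powr E"
    and p: "prime p" "k > 0"
    and par: "B \<ge> 1" "E > 0" "M > 0"
    and q: "real ((M + 1) * d) ^ 2 * B powr (1 / d + 2 * E / M) < real_of_int (p ^ k)"
  shows "card S \<le> (d + d) * max D M * d * (nat (p ^ k) * d)"
proof -
  define h where "h = (\<lambda>(a, b). (a mod p ^ k, b mod p))"
  have p0: "p > 0" using p(1) by (rule prime_gt_0_int)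
  have "card S \<le> (d + d) * max D M * d * card (h ` S)"
  proof (rule card_le_mult_card_image[OF S(1)])
    fix y assume "y \<in> h ` S"
    then obtain a0 b0 where ab: "(a0, b0) \<in> S" "y = h (a0, b0)" by auto
    have "finite {x\<in>S. h x = y} \<and> card {x\<in>S. h x = y} \<le> (d + d) * max D M * d"
    proof (rule residue_class_bound[OF F _ _ p(1) _ p(2) par q])
      show "bipoly_eval F a b = 0 \<and> [a = a0] (mod p ^ k) \<and> [b = b0] (mod p)"
        if "(a, b) \<in> {x\<in>S. h x = y}" for a b
        using that S(2)[of a b] ab by (auto simp: h_def cong_def)
    qed (use B S(2)[OF ab(1)] in auto)
    then show "card {x\<in>S. h x = y} \<le> (d + d) * max D M * d" by blast
  qed
  also have "card (h ` S) \<le> nat (p ^ k) * d"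
  proof -
    define R where "R a = {b\<in>{0..<p}. p dvd bipoly_eval F a b \<and> \<not> p dvd bipoly_eval (pderiv F) a b}" for a
    have R: "finite (R a)" "card (R a) \<le> d" for a
    proof -
      show "finite (R a)" by (rule finite_subset[of _ "{0..<p}"]) (auto simp: R_def)
      have "card (R a) \<le> degree (map_poly (\<lambda>c. poly c a) F)"
        unfolding R_def bipoly_eval_pderiv bipoly_eval_eq_poly_map[of F]
        by (rule card_simple_roots_mod_prime[OF p(1)])
      then show "card (R a) \<le> d" using F(2) degree_map_poly_le le_trans by blast
    qed
    have "h ` S \<subseteq> Sigma {0..<p ^ k} R"
    proof
      fix y assume "y \<in> h ` S"
      then obtain a b where ab: "(a, b) \<in> S" "y = (a mod p ^ k, b mod p)" by (auto simp: h_def)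
      \<comment> \<open>Since p divides \<open>p ^ k\<close>, the reduced pair is congruent to the
        point modulo p and is still a smooth zero there.\<close>
      have "[a mod p ^ k = a] (mod p)"
        using p(2) cong_dvd_modulus[of "a mod p ^ k" a "p ^ k" p] by (auto simp: dvd_power)
      moreover have "[b mod p = b] (mod p)" by simp
      ultimately have "[bipoly_eval P (a mod p ^ k) (b mod p) = bipoly_eval P a b] (mod p)" for P
        by (rule cong_bipoly_eval)
      then have "p dvd bipoly_eval P (a mod p ^ k) (b mod p) \<longleftrightarrow> p dvd bipoly_eval P a b" for P
        by (rule cong_dvd_iff)
      then show "y \<in> Sigma {0..<p ^ k} R"
        using S(2)[OF ab(1)] p0 by (auto simp: ab(2) R_def)
    qed
    then have "card (h ` S) \<le> card (Sigma {0..<p ^ k} R)"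
      using R by (intro card_mono) auto
    also have "\<dots> = (\<Sum>a\<in>{0..<p ^ k}. card (R a))" using R by (simp add: card_SigmaI)
    also have "\<dots> \<le> (\<Sum>a\<in>{0..<p ^ k}. d)" using R by (intro sum_mono)
    finally show ?thesis by simp
  qed
  finally show ?thesis by simp
qed

section \<open>Counting\<close>

lemma power_between:
  fixes p P :: real
  assumes "p > 1" "P \<ge> 1"
  shows "\<exists>k>0. P < p ^ k \<and> p ^ k \<le> p * P"
proof -
  define k where "k = (LEAST k. P < p ^ k)"
  have "\<exists>k. P < p ^ k" using assms(1) by (rule real_arch_pow)
  then have k: "P < p ^ k" unfolding k_def by (rule LeastI_ex)
  have "k > 0" using k assms(2) by (cases k) auto
  then obtain l where l: "k = Suc l" by (cases k) auto
  have "\<not> P < p ^ l" using not_less_Least[of l "\<lambda>k. P < p ^ k"] l by (simp add: k_def)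
  then show ?thesis using k l assms(1) by (intro exI[of _ k]) auto
qed

lemma abs_bipoly_eval_le:
  fixes F :: "int poly poly" and h H :: real
  assumes "degree F \<le> d" "\<And>j. degree (coeff F j) \<le> D"
    and "\<And>i j. \<bar>real_of_int (coeff (coeff F j) i)\<bar> \<le> h"
    and "\<And>i j. i \<le> D \<Longrightarrow> j \<le> d \<Longrightarrow> \<bar>real_of_int a\<bar> ^ i * \<bar>real_of_int b\<bar> ^ j \<le> H"
  shows "\<bar>real_of_int (bipoly_eval F a b)\<bar> \<le> real ((D + 1) * (d + 1)) * (h * H)"
proof -
  define m where "m = D + 1"
  define c where "c k = coeff (coeff F (k div m)) (k mod m)" for k
  have "F = bipoly_of m (d + 1) c"
    unfolding c_def using assms(1,2)
    by (intro bipoly_of_coeffs[symmetric]) (auto simp: m_def less_Suc_eq_le)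
  then have "bipoly_eval F a b = (\<Sum>k<m * (d + 1). c k * (a ^ (k mod m) * b ^ (k div m)))"
    using bipoly_eval_bipoly_of[of m "d + 1" c a b] by simp
  then have "\<bar>real_of_int (bipoly_eval F a b)\<bar> \<le>
      (\<Sum>k<m * (d + 1). \<bar>real_of_int (c k * (a ^ (k mod m) * b ^ (k div m)))\<bar>)"
    by (simp only: of_int_sum) (rule sum_abs)
  also have "\<dots> \<le> (\<Sum>k<m * (d + 1). h * H)"
  proof (rule sum_mono)
    fix k assume "k \<in> {..<m * (d + 1)}"
    then have "k < (d + 1) * m" by (simp add: mult.commute)
    then have "k div m < d + 1" by (rule less_mult_imp_div_less)
    moreover have "k mod m < m" by (simp add: m_def)
    ultimately have "\<bar>real_of_int a\<bar> ^ (k mod m) * \<bar>real_of_int b\<bar> ^ (k div m) \<le> H"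
      by (intro assms(4)) (auto simp: m_def)
    moreover have "h \<ge> 0" using assms(3)[of 0 0] by linarith
    ultimately have "\<bar>real_of_int (c k)\<bar> * (\<bar>real_of_int a\<bar> ^ (k mod m) * \<bar>real_of_int b\<bar> ^ (k div m)) \<le> h * H"
      using assms(3) unfolding c_def by (intro mult_mono) auto
    then show "\<bar>real_of_int (c k * (a ^ (k mod m) * b ^ (k div m)))\<bar> \<le> h * H"
      by (simp add: abs_mult power_abs)
  qed
  finally show ?thesis by (simp add: m_def)
qed

lemma coeff_coeff_pderiv:
  "coeff (coeff (pderiv F) j) i = of_nat (Suc j) * coeff (coeff F (Suc j)) i"
  unfolding coeff_pderiv of_nat_poly by simp

lemma degree_coeff_pderiv_le: "degree (coeff (pderiv F) j) \<le> degree (coeff F (Suc j))"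
  by (rule degree_le) (simp add: coeff_coeff_pderiv coeff_eq_0 del: of_nat_Suc)

text \<open>Points where the x2-derivative vanishes are counted by Bezout, as F cannot divide a
  polynomial of lower x2-degree. All others are smooth modulo one of at most y primes, each
  contributing a constant times y P; hence the factor \<open>y ^ 2\<close>.\<close>

lemma points_bound_small_primes:
  fixes F :: "int poly poly" and B E y :: real
  assumes F: "irreducible_over_Qbar F" "degree F = d" "d > 0" "\<And>j. degree (coeff F j) \<le> D"
    and S: "finite S" "\<And>a b. (a, b) \<in> S \<Longrightarrow> bipoly_eval F a b = 0"
    and B: "\<And>a b. (a, b) \<in> S \<Longrightarrow> \<bar>real_of_int a\<bar> \<le> B \<and> \<bar>real_of_int b\<bar> \<le> B powr E"
    and y: "y \<ge> 0" "\<And>a b. (a, b) \<in> S \<Longrightarrow> bipoly_eval (pderiv F) a b \<noteq> 0 \<Longrightarrow>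
      \<exists>p::int. prime p \<and> \<not> p dvd bipoly_eval (pderiv F) a b \<and> real_of_int p \<le> y"
    and par: "B \<ge> 1" "E > 0" "M > 0"
  shows "real (card S) \<le> real ((d + d) * D * d) + real ((d + d) * max D M * d * d) * y ^ 2 *
    (real ((M + 1) * d) ^ 2 * B powr (1 / d + 2 * E / M))"
proof -
  define P where "P = real ((M + 1) * d) ^ 2 * B powr (1 / d + 2 * E / M)"
  define K where "K = (d + d) * max D M * d"
  have "P \<ge> 1 * 1" unfolding P_def
    using par F(3) by (intro mult_mono ge_one_powr_ge_zero one_le_power)
      (auto simp: Suc_le_eq simp flip: of_nat_Suc of_nat_mult)
  then have P1: "P \<ge> 1" by simp
  define S0 where "S0 = {(a, b). bipoly_eval F a b = 0 \<and> bipoly_eval (pderiv F) a b = 0}"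
  have pd: "pderiv F \<noteq> 0" "degree (pderiv F) = d - 1"
    using F(2,3) by (auto simp: pderiv_eq_0_iff degree_pderiv)
  have "\<not> to_Qbar F dvd to_Qbar (pderiv F)"
  proof
    assume "to_Qbar F dvd to_Qbar (pderiv F)"
    then have "degree (to_Qbar F) \<le> degree (to_Qbar (pderiv F))"
      using pd(1) by (intro dvd_imp_degree_le) auto
    then show False using pd(2) F(2,3) by simp
  qed
  moreover have "degree (coeff (pderiv F) j) \<le> D" for j
    using F(4) degree_coeff_pderiv_le le_trans by blast
  ultimately have S0: "finite S0" "card S0 \<le> (d + d) * D * d"
    using common_zeros_bound[of F D "pderiv F" d] F pd(2) by (auto simp: S0_def)
  define Q where "Q = {p::int. prime p \<and> real_of_int p \<le> y}"
  have Qsub: "Q \<subseteq> {1..\<lfloor>y\<rfloor>}" by (auto simp: Q_def le_floor_iff dest: prime_gt_0_int)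
  then have Qfin: "finite Q" by (rule finite_subset) simp
  have "card Q \<le> card {1..\<lfloor>y\<rfloor>}" using Qsub by (intro card_mono) auto
  then have Qcard: "real (card Q) \<le> y" using y(1) by simp linarith
  define T where "T p = {(a, b)\<in>S. \<not> p dvd bipoly_eval (pderiv F) a b}" for p
  have Tfin: "finite (T p)" for p
    by (rule finite_subset[OF _ S(1)]) (auto simp: T_def)
  have T: "real (card (T p)) \<le> real (K * d) * (y * P)" if p: "p \<in> Q" for p
  proof -
    have pp: "prime p" "real_of_int p \<le> y" using p by (auto simp: Q_def)
    then have "real_of_int p > 1" using prime_gt_1_int[of p] by simp
    \<comment> \<open>The power of p passes the threshold \<open>P\<close> required by the
      determinant estimate, overshooting by a factor of at most p.\<close>
    then obtain k where k: "k > 0" "P < real_of_int p ^ k" "real_of_int p ^ k \<le> real_of_int p * P"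
      using power_between[OF _ P1] by blast
    have "card (T p) \<le> (d + d) * max D M * d * (nat (p ^ k) * d)"
      using k(2) unfolding P_def
      by (intro smooth_points_bound[OF F Tfin _ _ pp(1) k(1) par])
         (use S(2) B in \<open>auto simp: T_def\<close>)
    also have "\<dots> = K * d * nat (p ^ k)" by (simp add: K_def)
    finally have "real (card (T p)) \<le> real (K * d) * real (nat (p ^ k))"
      by (metis of_nat_le_iff of_nat_mult)
    also have "real (nat (p ^ k)) = real_of_int p ^ k"
      using prime_gt_0_int[OF pp(1)] by simp
    also have "\<dots> \<le> y * P" using k(3) pp(2) P1 mult_right_mono[of "real_of_int p" y P] by linarith
    finally show ?thesis by (simp add: mult_left_mono)
  qed
  have "S \<subseteq> S0 \<union> (\<Union>p\<in>Q. T p)"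
  proof
    fix x assume x: "x \<in> S"
    obtain a b where ab: "x = (a, b)" by fastforce
    show "x \<in> S0 \<union> (\<Union>p\<in>Q. T p)"
    proof (cases "bipoly_eval (pderiv F) a b = 0")
      case True
      then show ?thesis using S(2) x ab by (simp add: S0_def)
    next
      case False
      then obtain p where "p \<in> Q" "\<not> p dvd bipoly_eval (pderiv F) a b"
        using y(2)[of a b] x ab unfolding Q_def by blast
      then show ?thesis using x ab by (auto simp: T_def)
    qed
  qed
  then have "card S \<le> card (S0 \<union> (\<Union>p\<in>Q. T p))"
    using S0 Qfin Tfin by (intro card_mono) auto
  also have "\<dots> \<le> card S0 + card (\<Union>p\<in>Q. T p)" by (rule card_Un_le)
  also have "\<dots> \<le> (d + d) * D * d + (\<Sum>p\<in>Q. card (T p))"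
    using S0 Qfin by (intro add_mono card_UN_le) auto
  finally have "real (card S) \<le> real ((d + d) * D * d) + (\<Sum>p\<in>Q. real (card (T p)))"
    by (metis of_nat_add of_nat_le_iff of_nat_sum)
  also have "(\<Sum>p\<in>Q. real (card (T p))) \<le> (\<Sum>p\<in>Q. real (K * d) * (y * P))"
    using T by (rule sum_mono)
  also have "\<dots> = real (card Q) * (real (K * d) * (y * P))" by simp
  also have "\<dots> \<le> y * (real (K * d) * (y * P))"
    using Qcard y(1) P1 by (intro mult_right_mono) auto
  finally show ?thesis by (simp add: K_def P_def power2_eq_square algebra_simps)
qed

section \<open>Choice of the parameters and conclusion\<close>

lemma degree_coeff_le_total_degree: "degree (coeff F j) \<le> total_degree F"
proof (cases "coeff F j = 0")
  case False
  then have "degree (coeff F j) + j \<in> {i + j | i j. coeff (coeff F j) i \<noteq> 0}"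
    by (intro CollectI exI[of _ "degree (coeff F j)"] exI[of _ j]) simp
  then have "degree (coeff F j) + j \<le> total_degree F"
    unfolding total_degree_def using finite_total_degree_set[of F] by (intro Max_ge) auto
  then show ?thesis by simp
qed auto

theorem theoremA1:
  fixes E \<epsilon> :: real and d :: nat
  assumes "E > 1" and "d \<ge> 1" and "\<epsilon> > 0"
  shows "\<exists>C::real. C > 0 \<and>
    (\<forall>(F :: int poly poly) (B1 :: real) (B2 :: real).
       irreducible_over_Qbar F \<longrightarrow> Polynomial.degree F = d \<longrightarrow>
       B1 > 1 \<longrightarrow> B2 > 1 \<longrightarrow> B2 \<le> B1 powr E \<longrightarrow> real (total_degree F) \<le> E \<longrightarrow>
       real (card (integral_points F B1 B2)) \<le> C * B1 powr (1 / real d + \<epsilon>))"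
proof -
  define D where "D = nat \<lfloor>E\<rfloor>"
  \<comment> \<open>This makes the loss 2E/M in the exponent at most \<epsilon>/2.\<close>
  define M where "M = nat \<lceil>4 * E / \<epsilon>\<rceil>"
  have "4 * E / \<epsilon> > 0" using assms by simp
  then have M: "M > 0" "real M \<ge> 4 * E / \<epsilon>" by (auto simp: M_def)
  have ME: "2 * E / M \<le> \<epsilon> / 2" using M assms by (simp add: field_simps)
  define N where "N = (D + 1) * (d + 1)"
  \<comment> \<open>With \<open>H = B1 powr (D + E * d)\<close>, a value of the x2-derivative of G
    is at most a constant times \<open>H ^ Suc N\<close>: N factors come from the coefficients of G
    and one from the monomials.\<close>
  define c1 where "c1 = (D + E * d) * real (Suc N)"
  have N0: "N > 0" by (simp add: N_def)
  have "D + E * d > 0" using assms by (intro add_nonneg_pos) auto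
  then have c1: "c1 > 0" unfolding c1_def by (intro mult_pos_pos) auto
  \<comment> \<open>There are N monomials; d comes from differentiation and \<open>fact N\<close>
    from Cramer's rule.\<close>
  define C1 where "C1 = real N * (real d * fact N)"
  have C1: "C1 > 0" using N0 assms by (simp add: C1_def)
  \<comment> \<open>The primes are then bounded by a constant times
    \<open>B1 powr (\<epsilon> / 4)\<close>. Their bound y enters squared and costs \<epsilon>/2;
    the other half of \<epsilon> pays for M.\<close>
  define \<delta> where "\<delta> = \<epsilon> / (4 * c1)"
  have \<delta>: "\<delta> > 0" using assms c1 by (simp add: \<delta>_def)
  then obtain C2 where C2: "C2 > 0" "\<And>n. n > 0 \<Longrightarrow> \<exists>p. prime p \<and> \<not> p dvd n \<and> real p \<le> C2 * real n powr \<delta>"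
    using small_prime_not_dvd by blast
  define C3 where "C3 = C2 * C1 powr \<delta>"
  have C3: "C3 > 0" using C2(1) C1 by (simp add: C3_def)
  define K1 where "K1 = real ((d + d) * D * d)"
  define K2 where "K2 = real ((d + d) * max D M * d * d) * C3 ^ 2 * real ((M + 1) * d) ^ 2"
  have K: "K1 \<ge> 0" "K2 \<ge> 0" by (auto simp: K1_def K2_def)
  show ?thesis
  proof (intro exI[of _ "K1 + K2 + 1"] conjI allI impI)
    show "0 < K1 + K2 + 1" using K by simp
    fix F :: "int poly poly" and B1 B2 :: real
    assume F: "irreducible_over_Qbar F" "degree F = d" and B1: "B1 > 1" and "B2 > 1"
      and B2: "B2 \<le> B1 powr E" and tot: "real (total_degree F) \<le> E"
    define S where "S = integral_points F B1 B2"
    have Sfin: "finite S" unfolding S_def by (rule finite_integral_points)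
    have FD: "degree (coeff F j) \<le> D" for j
      using degree_coeff_le_total_degree[of F j] tot assms(1) unfolding D_def
      by (meson le_nat_floor le_trans)
    have SB: "\<bar>real_of_int a\<bar> \<le> B1 \<and> \<bar>real_of_int b\<bar> \<le> B1 powr E" if "(a, b) \<in> S" for a b
      using that B2 by (auto simp: S_def integral_points_def)
    define H where "H = B1 powr (D + E * d)"
    have H1: "H \<ge> 1" using B1 assms by (auto simp: H_def intro!: ge_one_powr_ge_zero)
    have HS: "\<bar>real_of_int a\<bar> ^ i * \<bar>real_of_int b\<bar> ^ j \<le> H"
      if "(a, b) \<in> S" "i \<le> D" "j \<le> d" for a b i j
    proof -
      have "\<bar>real_of_int a\<bar> ^ i \<le> B1 ^ i" using SB[OF that(1)] by (intro power_mono) auto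
      also have "\<dots> \<le> B1 ^ D" using that B1 by (intro power_increasing) auto
      finally have 1: "\<bar>real_of_int a\<bar> ^ i \<le> B1 ^ D" .
      have "\<bar>real_of_int b\<bar> ^ j \<le> (B1 powr E) ^ j" using SB[OF that(1)] by (intro power_mono) auto
      also have "\<dots> \<le> (B1 powr E) ^ d"
        using that B1 assms by (intro power_increasing ge_one_powr_ge_zero) auto
      finally have "\<bar>real_of_int a\<bar> ^ i * \<bar>real_of_int b\<bar> ^ j \<le> B1 ^ D * (B1 powr E) ^ d"
        using 1 B1 by (intro mult_mono) auto
      also have "\<dots> = H"
        using B1 by (simp add: H_def powr_add powr_powr powr_realpow flip: powr_realpow[of "B1 powr E" d])
      finally show ?thesis .
    qed
    have Bge: "B1 powr (1 / d + \<epsilon>) \<ge> 1" using B1 assms by (auto intro!: ge_one_powr_ge_zero)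
    have "real (card S) \<le> K1 + K2 * B1 powr (1 / d + \<epsilon>)"
    proof -
      \<comment> \<open>In the second case G replaces F: it vanishes on \<open>S\<close>, has
        x2-degree d and x1-degree at most \<open>D\<close>, and its coefficients are polynomially
        bounded in \<open>B1\<close>.\<close>
      from small_height_equation[OF F _ FD _ H1 HS, of S]
      consider "card S \<le> (d + d) * D * d"
        | G where "irreducible_over_Qbar G" "degree G = d" "\<And>j. degree (coeff G j) \<le> D"
          "\<And>a b. (a, b) \<in> S \<Longrightarrow> bipoly_eval G a b = 0"
          "\<And>i j. \<bar>real_of_int (coeff (coeff G j) i)\<bar> \<le> fact N * H ^ N"
        using assms(2) by (auto simp: S_def integral_points_def N_def)
      then show ?thesis
      proof cases
        case 1
        then have "real (card S) \<le> K1" unfolding K1_def by (simp only: of_nat_le_iff)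
        moreover have "K2 * B1 powr (1 / d + \<epsilon>) \<ge> 0" using K by simp
        ultimately show ?thesis by linarith
      next
        case 2
        define y where "y = C3 * B1 powr (\<epsilon> / 4)"
        have prime_ex: "\<exists>p::int. prime p \<and> \<not> p dvd bipoly_eval (pderiv G) a b \<and> real_of_int p \<le> y"
          if ab: "(a, b) \<in> S" and nz: "bipoly_eval (pderiv G) a b \<noteq> 0" for a b
        proof -
          define n where "n = nat \<bar>bipoly_eval (pderiv G) a b\<bar>"
          have "\<bar>real_of_int (bipoly_eval (pderiv G) a b)\<bar> \<le>
              real ((D + 1) * (d + 1)) * ((real d * (fact N * H ^ N)) * H)"
          proof (rule abs_bipoly_eval_le)
            show "degree (pderiv G) \<le> d" using 2(2) by (simp add: degree_pderiv)
            show "degree (coeff (pderiv G) j) \<le> D" for j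
              using 2(3) degree_coeff_pderiv_le le_trans by blast
            show "\<bar>real_of_int (coeff (coeff (pderiv G) j) i)\<bar> \<le> real d * (fact N * H ^ N)" for i j
            proof (cases "Suc j \<le> d")
              case True
              have "coeff (coeff (pderiv G) j) i = int (Suc j) * coeff (coeff G (Suc j)) i"
                by (rule coeff_coeff_pderiv)
              then have "\<bar>real_of_int (coeff (coeff (pderiv G) j) i)\<bar> =
                  real (Suc j) * \<bar>real_of_int (coeff (coeff G (Suc j)) i)\<bar>"
                by (simp add: abs_mult)
              also have "\<dots> \<le> real d * (fact N * H ^ N)"
                using True 2(5) by (intro mult_mono) (auto simp del: of_nat_Suc)
              finally show ?thesis .
            next
              case False
              then have "coeff G (Suc j) = 0" using 2(2) by (intro coeff_eq_0) auto
              then show ?thesis using H1 by (simp add: coeff_pderiv)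
            qed
          qed (use HS[OF ab] in auto)
          also have "\<dots> = C1 * H ^ Suc N" by (simp add: C1_def N_def algebra_simps)
          also have "H ^ Suc N = B1 powr c1"
          proof -
            have "H ^ Suc N = H powr real (Suc N)" using H1 by (intro powr_realpow[symmetric]) simp
            then show ?thesis by (simp only: H_def c1_def powr_powr)
          qed
          finally have n: "real n \<le> C1 * B1 powr c1" by (simp add: n_def)
          have "n > 0" using nz by (simp add: n_def)
          then obtain p where p: "prime p" "\<not> p dvd n" "real p \<le> C2 * real n powr \<delta>"
            using C2(2) by blast
          have "real n powr \<delta> \<le> (C1 * B1 powr c1) powr \<delta>"
            using n \<delta> by (intro powr_mono2) auto
          also have "\<dots> = C1 powr \<delta> * B1 powr (\<epsilon> / 4)"
            using c1 by (simp add: powr_mult powr_powr \<delta>_def)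
          finally have "C2 * real n powr \<delta> \<le> y"
            using C2(1) by (simp add: y_def C3_def mult.assoc mult_left_mono)
          then have "real_of_int (int p) \<le> y" using p(3) by simp
          moreover have "\<not> int p dvd bipoly_eval (pderiv G) a b"
            using p(2) by (simp add: n_def dvd_nat_abs_iff)
          ultimately show ?thesis using p(1) by (intro exI[of _ "int p"]) auto
        qed
        have "real (card S) \<le> K1 + real ((d + d) * max D M * d * d) * y ^ 2 *
            (real ((M + 1) * d) ^ 2 * B1 powr (1 / d + 2 * E / M))"
          unfolding K1_def
        proof (rule points_bound_small_primes[OF 2(1,2) _ 2(3) Sfin 2(4) SB _ prime_ex])
          show "y \<ge> 0" using C3 by (simp add: y_def)
        qed (use assms B1 M in auto)
        also have "\<dots> = K1 + K2 * B1 powr (1 / d + 2 * E / M + \<epsilon> / 2)"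
        proof -
          have "(B1 powr (\<epsilon> / 4)) ^ 2 = B1 powr (\<epsilon> / 2)"
            using B1 by (simp add: power2_eq_square flip: powr_add)
          then show ?thesis
            by (simp add: y_def K2_def power_mult_distrib powr_add)
        qed
        also have "\<dots> \<le> K1 + K2 * B1 powr (1 / d + \<epsilon>)"
          using K ME B1 by (intro add_left_mono mult_left_mono powr_mono) auto
        finally show ?thesis .
      qed
    qed
    also have "\<dots> \<le> (K1 + K2 + 1) * B1 powr (1 / d + \<epsilon>)"
      using K Bge mult_left_mono[of 1 "B1 powr (1 / d + \<epsilon>)" K1] by (simp add: algebra_simps)
    finally show "real (card (integral_points F B1 B2)) \<le> (K1 + K2 + 1) * B1 powr (1 / real d + \<epsilon>)"
      by (simp add: S_def)
  qed
qed

end
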